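(* Consider the system under the PULL algorithm. Suppose that $B_j=\infty$ for some (or all) $j\in\mathcal{J}$ (in which case only the version PULL-2 is considered). Then, for all sufficiently large $n$, the Markov process $s^n(\cdot)$ is ergodic.
   Context: Model. There are $J\ge 1$ server pools, indexed by $j\in\mathcal{J}=\{1,\dots,J\}$; pool $j$ consists of $N_j$ identical servers, $\mathcal{N}_j$ denotes the set of servers in pool $j$, and $\mathcal{N}=\cup_j\mathcal{N}_j$. Service times are independent; at a server of pool $j$ they are exponential with mean $1/\mu_j\in(0,\infty)$. Each server serves its queue in first-come-first-serve order (only the head-of-line customer is served). The buffer size (maximum queue length, including the customer in service) at a server of pool $j$ is $B_j\in\{1,2,\dots\}\cup\{\infty\}$; a customer sent to a server in pool $j$ whose queue length equals the finite value $B_j$ is blocked (lost). Customers arrive as a Poisson process of rate $\Lambda$; each arriving customer is assigned uniformly at random, independently, to one of $R\ge1$ routers $r\in\mathcal{R}=\{1,\dots,R\}$, which must immediately send it to a server or block it (so arrivals to the routers are independent Poisson processes of rate $\Lambda/R$). Scaling. $n=\sum_j N_j$ is the total number of servers and the scaling parameter, which goes to infinity; $\Lambda=\lambda n$, $N_j=\beta_j n$, with fixed constants $\lambda>0,\beta_j>0$, $\sum_j\beta_j=1$; only values of $n$ with all $\beta_j n$ integer are considered. It is assumed that $\lambda<\sum_j\beta_j\mu_j$. $J$, $R$, $\mu_j$, $B_j$ do not depend on $n$. PULL-2 algorithm. (a) At any time each idle server has exactly one pull-message, located at one of the routers; a pull-message at router $r$ is called an $r$-pull-message. (b) When a server becomes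 idle after a service completion, a pull-message from it is placed at a router chosen uniformly at random. (c) When a customer arrives at an idle server, that server's pull-message is destroyed (wherever it is located). (d) When a customer arrives at router $r$ and there are $r$-pull-messages, the customer is sent to one of the corresponding idle servers, chosen uniformly at random. (e) If there are no $r$-pull-messages, the customer is sent to a server chosen uniformly at random among all servers in the system (where it is blocked if that server's buffer is full). (The other version, PULL-1, which blocks customers not finding a pull-message at their router, is only considered with all $B_j=1$.) State. $S^n=(Q_i^n,D_i^n,\ i\in\mathcal{N})$, where $Q_i^n\in\mathbb{Z}_+$ is the (finite) queue length at server $i$, and $D^n_i\in\mathcal{R}$ is the router holding the pull-message of $i$ if $Q^n_i=0$, and $D^n_i=0$ if $Q_i^n>0$. The mean-field state is $s^n=(x^n,\xi^n)$, $x^n=(x^n_{k,j},k\in\mathbb{Z}_+,j\in\mathcal{J})$, $\xi^n=(\xi^n_{r,j},r\in\mathcal{R},j\in\mathcal{J})$, where $x^n_{k,j}$ is the fraction (out of all $n$ servers) of servers that are in pool $j$ and have queue length at least $k$, and $\xi^n_{r,j}$ is the fraction (out of all $n$) of servers that are idle, in pool $j$, and have their pull-message at router $r$. $s^n(\cdot)$ is a continuous-time irreducible Markov process on a countable state space; ergodic means positive recurrent (equivalently, having a unique stationary distribution). *)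

theory Defs
  imports "HOL-Probability.Probability" "HOL-Library.Extended_Nat"
begin

text \<open>Markov jump processes on a countable state space with bounded transition rates.
  A trajectory is encoded by its successive states and holding times. For a rate function
  \<open>q\<close>, only the off-diagonal values matter.\<close>

type_synonym 's trajectory = "nat \<Rightarrow> 's \<times> real"

definition exit_rate :: "('s \<Rightarrow> 's \<Rightarrow> real) \<Rightarrow> 's \<Rightarrow> real" where
  "exit_rate q s = (\<Sum>\<^sub>\<infinity>s'\<in>-{s}. q s s')"

definition jump_prob :: "('s \<Rightarrow> 's \<Rightarrow> real) \<Rightarrow> 's \<Rightarrow> 's \<Rightarrow> real" where
  "jump_prob q s s' = (if s' = s then 0 else q s s' / exit_rate q s)"

text \<open>\<open>M\<close> is the law of the process with rates \<open>q\<close> started in \<open>s\<close>: the visited states form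
  a Markov chain with transition matrix \<open>jump_prob q\<close>, and given these states the holding
  times are independent and exponential with the corresponding exit rates. All exit rates are
  meant to be positive (no absorbing states).\<close>

definition jump_process_law ::
    "('s \<Rightarrow> 's \<Rightarrow> real) \<Rightarrow> 's \<Rightarrow> 's trajectory measure \<Rightarrow> bool" where
  "jump_process_law q s M \<longleftrightarrow>
     prob_space M \<and>
     sets M = sets (\<Pi>\<^sub>M k\<in>UNIV. count_space UNIV \<Otimes>\<^sub>M (borel :: real measure)) \<and>
     (\<forall>k ys hs. (\<forall>i\<le>k. 0 \<le> hs i) \<longrightarrow>
        measure M {\<omega> \<in> space M. \<forall>i\<le>k. fst (\<omega> i) = ys i \<and> hs i < snd (\<omega> i)} =
          of_bool (ys 0 = s) * (\<Prod>i<k. jump_prob q (ys i) (ys (Suc i))) *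
          (\<Prod>i\<le>k. exp (- exit_rate q (ys i) * hs i)))"

text \<open>The state at time \<open>t \<ge> 0\<close>. It is unspecified if \<open>t\<close> is not before the explosion time,
  an event of probability zero when the exit rates are bounded.\<close>

definition state_at :: "'s trajectory \<Rightarrow> real \<Rightarrow> 's" where
  "state_at \<omega> t = fst (\<omega> (LEAST k. t < (\<Sum>i\<le>k. snd (\<omega> i))))"

definition return_time :: "(real \<Rightarrow> 'z) \<Rightarrow> ennreal" where
  "return_time X =
     (INF t \<in> {t. X t = X 0 \<and> (\<exists>u. 0 \<le> u \<and> u < t \<and> X u \<noteq> X 0)}. ennreal t)"

text \<open>Irreducibility and positive recurrence of the process \<open>Z(t) = f (S(t))\<close>, where \<open>S\<close> is
  the jump process with rates \<open>q\<close> on the state space \<open>\<Omega>\<close> and \<open>f\<close> is such that \<open>Z\<close> is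
  again a Markov process, with state space \<open>f ` \<Omega>\<close>. Positive recurrence: the mean return time
  of \<open>Z\<close> to each of its states is finite.\<close>

definition irreducible_image ::
    "('s \<Rightarrow> 's \<Rightarrow> real) \<Rightarrow> 's set \<Rightarrow> ('s \<Rightarrow> 'z) \<Rightarrow> bool" where
  "irreducible_image q \<Omega> f \<longleftrightarrow>
     (\<forall>s\<in>\<Omega>. \<forall>z\<in>f ` \<Omega>. \<exists>s'. (s, s') \<in> {(a, b). a \<noteq> b \<and> 0 < q a b}\<^sup>* \<and> f s' = z)"

definition positive_recurrent_image ::
    "('s \<Rightarrow> 's \<Rightarrow> real) \<Rightarrow> 's set \<Rightarrow> ('s \<Rightarrow> 'z) \<Rightarrow> bool" where
  "positive_recurrent_image q \<Omega> f \<longleftrightarrow>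
     (\<forall>s\<in>\<Omega>. \<forall>M. jump_process_law q s M \<longrightarrow>
        (\<integral>\<^sup>+\<omega>. return_time (\<lambda>t. f (state_at \<omega> t)) \<partial>M) < \<infinity>)"

definition ergodic_image ::
    "('s \<Rightarrow> 's \<Rightarrow> real) \<Rightarrow> 's set \<Rightarrow> ('s \<Rightarrow> 'z) \<Rightarrow> bool" where
  "ergodic_image q \<Omega> f \<longleftrightarrow> irreducible_image q \<Omega> f \<and> positive_recurrent_image q \<Omega> f"

text \<open>Pools and routers are numbered from 1; a server is a pair of its pool and its number
  within the pool.\<close>

record pull_system =
  num_pools :: nat
  num_routers :: nat
  pool_size :: "nat \<Rightarrow> nat"
  buffer :: "nat \<Rightarrow> enat"
  service_rate :: "nat \<Rightarrow> real"
  arrival_rate :: real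

type_synonym server = "nat \<times> nat"

definition servers :: "pull_system \<Rightarrow> server set" where
  "servers P = (SIGMA j : {1..num_pools P}. {1..pool_size P j})"

text \<open>A state \<open>(Q, D)\<close> consists of the queue lengths and the pull-message locations; 
  \<open>D i = 0\<close> means that server \<open>i\<close> has no pull-message. Both are 0 outside the set of servers.\<close>

type_synonym pull_state = "(server \<Rightarrow> nat) \<times> (server \<Rightarrow> nat)"

definition pull_states :: "pull_system \<Rightarrow> pull_state set" where
  "pull_states P = {(Q, D).
     (\<forall>i\<in>servers P. enat (Q i) \<le> buffer P (fst i) \<and>
        (if Q i = 0 then D i \<in> {1..num_routers P} else D i = 0)) \<and>
     (\<forall>i. i \<notin> servers P \<longrightarrow> Q i = 0 \<and> D i = 0)}"

definition routing_prob :: "pull_system \<Rightarrow> pull_state \<Rightarrow> nat \<Rightarrow> server \<Rightarrow> real" where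
  "routing_prob P = (\<lambda>(Q, D) r i.
     let A = {i \<in> servers P. D i = r}
     in if A \<noteq> {} then of_bool (i \<in> A) / real (card A)
        else of_bool (i \<in> servers P) / real (card (servers P)))"

definition arrive :: "server \<Rightarrow> pull_state \<Rightarrow> pull_state" where
  "arrive i = (\<lambda>(Q, D). (Q(i := Q i + 1), D(i := 0)))"

definition depart :: "server \<Rightarrow> nat \<Rightarrow> pull_state \<Rightarrow> pull_state" where
  "depart i r = (\<lambda>(Q, D). (Q(i := Q i - 1), D(i := (if Q i = 1 then r else 0))))"

text \<open>Transition rates under PULL-2. A customer sent to a server with a full buffer is lost and
  causes no transition. At every service completion a router \<open>r\<close> is drawn uniformly; it is
  used only if the server becomes idle.\<close>

definition pull2_rate :: "pull_system \<Rightarrow> pull_state \<Rightarrow> pull_state \<Rightarrow> real" where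
  "pull2_rate P S S' =
     (\<Sum>r = 1..num_routers P. \<Sum>i | i \<in> servers P \<and> enat (fst S i) < buffer P (fst i).
        arrival_rate P / real (num_routers P) * routing_prob P S r i
          * of_bool (S' = arrive i S)) +
     (\<Sum>i | i \<in> servers P \<and> 0 < fst S i. \<Sum>r = 1..num_routers P.
        service_rate P (fst i) / real (num_routers P) * of_bool (S' = depart i r S))"

text \<open>The mean-field state \<open>(x, \<xi>)\<close>, with \<open>x k j\<close> and \<open>\<xi> r j\<close>.\<close>

definition mean_field ::
    "pull_system \<Rightarrow> pull_state \<Rightarrow> (nat \<Rightarrow> nat \<Rightarrow> real) \<times> (nat \<Rightarrow> nat \<Rightarrow> real)" where
  "mean_field P = (\<lambda>(Q, D).
     (\<lambda>k j. real (card {i \<in> servers P. fst i = j \<and> k \<le> Q i}) / real (card (servers P)),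
      \<lambda>r j. real (card {i \<in> servers P. fst i = j \<and> Q i = 0 \<and> D i = r})
              / real (card (servers P))))"

definition pull2_mean_field_ergodic :: "pull_system \<Rightarrow> bool" where
  "pull2_mean_field_ergodic P \<longleftrightarrow>
     ergodic_image (pull2_rate P) (pull_states P) (mean_field P)"

end

theory Submission
  imports Defs
begin

text \<open>The proof is by a Lyapunov function. Let \<open>\<alpha>\<close> be the fraction of routers without messages,
  \<open>M\<close> the number of idle servers and \<open>U = (\<Sum>i. (Q i - 1)\<^sup>+)\<close>. A busy server has arrival rate at
  most \<open>\<alpha> \<lambda>\<close>, so the quadratic function \<open>(\<Sum>i. ((Q i - 1)\<^sup>+)\<^sup>2 / 2)\<close> has negative drift unless
  \<open>\<alpha>\<close> is large. The sum of squares of the numbers of messages at the routers, minus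
  \<open>M\<^sup>2\<close> divided by the number of routers, decreases at rate at least of order \<open>\<alpha> M n - O(n)\<close>, so
  \<open>\<alpha> M\<close> is \<open>O(1)\<close> on average. If \<open>M\<close> is less than a small multiple of \<open>n\<close>, then nearly all
  servers work and spare capacity makes \<open>U - M\<close> decrease at a rate of order \<open>n\<close>. Hence a suitable
  combination \<open>\<Phi> = U + O_n(1)\<close> satisfies \<open>A \<Phi> \<le> C - c n \<alpha>\<close>, where \<open>A\<close> is the generator and the
  constants do not depend on \<open>n\<close>, and a small multiple of \<open>\<Phi>\<^sup>2 / n\<close> compensates the term
  \<open>\<alpha> \<lambda> U\<close> in the drift of the quadratic function up to \<open>O(U / n)\<close>.\<close>

subsection \<open>Drift conditions for jump processes\<close>

text \<open>Uniform routing alone can be unstable: \<open>lam\<close> lies only below the average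
  service rate, so while all routers are empty a slow pool may receive more work than it can serve.
  The quadratic function by itself therefore fails. Nor is \<alpha> small in every state: a router
  can be empty although many servers are idle, when their messages lie elsewhere. The square of
  \<Phi> turns a bound on \<alpha> into one on \<alpha> U. The leading part of its generator is 2 U
  A \<Phi>; after division by n, the part - c n \<alpha> cancels the harmful \<alpha> \<lambda> U
  state by state. What is left is of the form C U / n, and n has to be large so that the service
  term beats it. The additive constants may grow with n, because positive recurrence is a statement
  about each n separately. Recurrence is asked of the mean-field image, and the return time starts
  to count only once the image has left its initial value. Every transition changes the image, so
  the return time of the full state is an upper bound.\<close>

definition drift :: "('s \<Rightarrow> 's \<Rightarrow> real) \<Rightarrow> ('s \<Rightarrow> real) \<Rightarrow> 's \<Rightarrow> real" where
  "drift q g s = (\<Sum>s' | s' \<noteq> s \<and> 0 < q s s'. q s s' * (g s' - g s))"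

text \<open>Linearity holds without finiteness of the successor set: over an infinite index set
  \<open>sum\<close> is 0 on both sides.\<close>

lemma drift_add: "drift q (\<lambda>s. g s + h s) s = drift q g s + drift q h s"
  unfolding drift_def sum.distrib[symmetric] by (intro sum.cong) (auto simp: algebra_simps)

lemma drift_cmult: "drift q (\<lambda>s. c * g s) s = c * drift q g s"
  unfolding drift_def sum_distrib_left by (intro sum.cong) (auto simp: algebra_simps)

lemma drift_diff: "drift q (\<lambda>s. g s - h s) s = drift q g s - drift q h s"
  unfolding drift_def sum_subtractf[symmetric] by (intro sum.cong) (auto simp: algebra_simps)

lemma drift_const: "drift q (\<lambda>s. c) s = 0"
  by (simp add: drift_def)

text \<open>The last sum is the squared-increment term of the generator. With bounded rates and
  bounded increments it is a constant, so the drift of a square is governed by the cross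
  term.\<close>

lemma drift_square:
  "drift q (\<lambda>s. (g s)\<^sup>2) s = 2 * g s * drift q g s +
     (\<Sum>s' | s' \<noteq> s \<and> 0 < q s s'. q s s' * (g s' - g s)\<^sup>2)"
  unfolding drift_def sum_distrib_left sum.distrib[symmetric]
  by (intro sum.cong) (auto simp: algebra_simps power2_eq_square)

text \<open>Trajectories of the jump chain are listed backwards, so that the head is the current state.\<close>

primrec paths :: "('s \<Rightarrow> 's set) \<Rightarrow> 's \<Rightarrow> nat \<Rightarrow> 's list set" where
  "paths N s 0 = {[s]}"
| "paths N s (Suc k) = (\<Union>xs\<in>paths N s k. (\<lambda>y. y # xs) ` N (hd xs))"

fun path_weight :: "('s \<Rightarrow> 's \<Rightarrow> real) \<Rightarrow> 's list \<Rightarrow> real" where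
  "path_weight p (y # x # xs) = p x y * path_weight p (x # xs)"
| "path_weight p xs = 1"

lemma length_paths: "xs \<in> paths N s k \<Longrightarrow> length xs = Suc k"
  by (induction k arbitrary: xs) auto

lemma last_paths: "xs \<in> paths N s k \<Longrightarrow> last xs = s"
proof (induction k arbitrary: xs)
  case (Suc k)
  then obtain ys y where "ys \<in> paths N s k" "xs = y # ys" by auto
  with Suc.IH[of ys] length_paths[of ys N s k] show ?case by auto
qed auto

lemma sum_paths_Suc:
  assumes "finite (paths N s k)" "\<And>xs. xs \<in> paths N s k \<Longrightarrow> finite (N (hd xs))"
  shows "(\<Sum>xs\<in>paths N s (Suc k). g xs) = (\<Sum>xs\<in>paths N s k. \<Sum>y\<in>N (hd xs). g (y # xs))"
proof -
  have "(\<Sum>xs\<in>paths N s (Suc k). g xs) =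
      (\<Sum>xs\<in>paths N s k. \<Sum>zs\<in>(\<lambda>y. y # xs) ` N (hd xs). g zs)"
    unfolding paths.simps by (intro sum.UNION_disjoint) (use assms in auto)
  also have "\<dots> = (\<Sum>xs\<in>paths N s k. \<Sum>y\<in>N (hd xs). g (y # xs))"
    by (intro sum.cong refl) (subst sum.reindex, auto simp: inj_on_def)
  finally show ?thesis .
qed

text \<open>Translates the weight of a reversed list into the forward product over indices in which
  \<open>jump_process_law\<close> is phrased.\<close>

lemma path_weight_eq_prod:
  "length xs = Suc k \<Longrightarrow> (\<Prod>i<k. p (rev xs ! i) (rev xs ! Suc i)) = path_weight p xs"
proof (induction p xs arbitrary: k rule: path_weight.induct)
  case (1 p y x xs)
  then obtain l where k: "k = Suc l" and l: "length (x # xs) = Suc l" by (cases k) auto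
  have "(\<Prod>i<l. p (rev (y # x # xs) ! i) (rev (y # x # xs) ! Suc i)) =
      (\<Prod>i<l. p (rev (x # xs) ! i) (rev (x # xs) ! Suc i))"
    using l by (intro prod.cong refl) (auto simp: nth_append)
  then show ?case
    using 1(1)[OF l] l unfolding k by (simp add: nth_append)
qed auto

lemma rev_nth_hd: "length xs = Suc k \<Longrightarrow> rev xs ! k = hd xs"
  by (cases xs) (auto simp: nth_append)

lemma rev_nth_last: "xs \<noteq> [] \<Longrightarrow> rev xs ! 0 = last xs"
  by (metis hd_conv_nth hd_rev rev_is_Nil_conv)

section \<open>Jump processes with rates bounded above and below\<close>

text \<open>\<open>qmax\<close> converts drift per unit of time into drift per jump.
  \<open>qmin\<close> bounds the transition probabilities from below (by \<open>qmin / qmax\<close>)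
  and makes the tails of the holding times uniformly geometric.\<close>

locale jump_rates =
  fixes q :: "'s \<Rightarrow> 's \<Rightarrow> real" and \<Omega> :: "'s set" and qmin qmax :: real
  assumes finite_succ: "s \<in> \<Omega> \<Longrightarrow> finite {s'. s' \<noteq> s \<and> 0 < q s s'}"
    and succ_nonempty: "s \<in> \<Omega> \<Longrightarrow> {s'. s' \<noteq> s \<and> 0 < q s s'} \<noteq> {}"
    and rate_nonneg: "s \<in> \<Omega> \<Longrightarrow> 0 \<le> q s s'"
    and succ_closed: "s \<in> \<Omega> \<Longrightarrow> s' \<noteq> s \<Longrightarrow> 0 < q s s' \<Longrightarrow> s' \<in> \<Omega>"
    and qmin_pos: "0 < qmin"
    and rate_ge: "s \<in> \<Omega> \<Longrightarrow> s' \<noteq> s \<Longrightarrow> 0 < q s s' \<Longrightarrow> qmin \<le> q s s'"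
    and exit_rate_le: "s \<in> \<Omega> \<Longrightarrow> exit_rate q s \<le> qmax"
begin

abbreviation succs :: "'s \<Rightarrow> 's set" where
  "succs s \<equiv> {s'. s' \<noteq> s \<and> 0 < q s s'}"

lemma exit_rate_eq:
  assumes "s \<in> \<Omega>"
  shows "exit_rate q s = (\<Sum>s'\<in>succs s. q s s')"
proof -
  have "q s x = 0" if "x \<in> - {s} - succs s" for x
    using rate_nonneg[OF assms, of x] that by auto
  then have "exit_rate q s = (\<Sum>\<^sub>\<infinity>s'\<in>succs s. q s s')"
    unfolding exit_rate_def by (intro infsum_cong_neutral) auto
  then show ?thesis
    using finite_succ[OF assms] by simp
qed

lemma exit_rate_ge:
  assumes "s \<in> \<Omega>"
  shows "qmin \<le> exit_rate q s"
proof -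
  obtain s' where s': "s' \<in> succs s"
    using succ_nonempty[OF assms] by auto
  have "q s s' \<le> (\<Sum>s'\<in>succs s. q s s')"
    by (intro member_le_sum s' finite_succ assms) (auto simp: rate_nonneg assms)
  then show ?thesis
    using rate_ge[OF assms, of s'] s' exit_rate_eq[OF assms] by auto
qed

lemma qmax_pos: "s \<in> \<Omega> \<Longrightarrow> 0 < qmax"
  using exit_rate_ge exit_rate_le qmin_pos by fastforce

lemma sum_jump_prob:
  assumes "s \<in> \<Omega>"
  shows "(\<Sum>s'\<in>succs s. jump_prob q s s' * g s') = (\<Sum>s'\<in>succs s. q s s' * g s') / exit_rate q s"
  unfolding sum_divide_distrib by (intro sum.cong) (auto simp: jump_prob_def)

lemma jump_prob_nonneg: "s \<in> \<Omega> \<Longrightarrow> 0 \<le> jump_prob q s s'"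
  using exit_rate_ge[of s] qmin_pos rate_nonneg[of s s'] by (auto simp: jump_prob_def)

lemma paths_in:
  assumes "s \<in> \<Omega>" "\<And>x. N x \<subseteq> succs x" "xs \<in> paths N s k"
  shows "set xs \<subseteq> \<Omega> \<and> hd xs \<in> \<Omega>"
  using assms(3)
proof (induction k arbitrary: xs)
  case 0 then show ?case using assms by auto
next
  case (Suc k)
  then obtain ys y where ys: "ys \<in> paths N s k" "xs = y # ys" "y \<in> N (hd ys)" by auto
  with Suc.IH[of ys] show ?case
    using succ_closed[of "hd ys" y] assms(2)[of "hd ys"] by auto
qed

lemma finite_paths:
  assumes "s \<in> \<Omega>" "\<And>x. N x \<subseteq> succs x"
  shows "finite (paths N s k)"
proof (induction k)
  case (Suc k)
  have "finite (N (hd xs))" if "xs \<in> paths N s k" for xs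
    using paths_in[OF assms that] finite_succ[of "hd xs"] assms(2) by (meson finite_subset)
  then show ?case using Suc by auto
qed auto

lemma path_weight_nonneg:
  assumes "s \<in> \<Omega>" "\<And>x. N x \<subseteq> succs x" "xs \<in> paths N s k"
  shows "0 \<le> path_weight (jump_prob q) xs"
  using assms(3)
proof (induction k arbitrary: xs)
  case (Suc k)
  then obtain ys y where ys: "ys \<in> paths N s k" "xs = y # ys" "y \<in> N (hd ys)" by auto
  then show ?case
    using Suc.IH[of ys] paths_in[OF assms(1,2) ys(1)] jump_prob_nonneg[of "hd ys" y]
    by (cases ys) auto
qed auto

lemma path_weight_Cons:
  "xs \<in> paths N s k \<Longrightarrow> path_weight p (y # xs) = p (hd xs) y * path_weight p xs"
  using length_paths[of xs N s k] by (cases xs) auto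

text \<open>Conditioning on the first \<open>k\<close> jumps averages \<open>g\<close> over the next
  one. If \<open>N\<close> omits successors, their mass is lost and not renormalised; this is how
  returning paths are killed below.\<close>

lemma sum_weighted_paths_Suc:
  assumes "s \<in> \<Omega>" "\<And>x. N x \<subseteq> succs x"
  shows "(\<Sum>xs\<in>paths N s (Suc k). path_weight (jump_prob q) xs * g (hd xs)) =
    (\<Sum>xs\<in>paths N s k. path_weight (jump_prob q) xs * (\<Sum>y\<in>N (hd xs). jump_prob q (hd xs) y * g y))"
proof -
  have "finite (N (hd xs))" if "xs \<in> paths N s k" for xs
    using paths_in[OF assms that] finite_succ[of "hd xs"] assms(2) by (meson finite_subset)
  then show ?thesis
    by (subst sum_paths_Suc)
      (auto simp: finite_paths[OF assms] path_weight_Cons sum_distrib_left algebra_simps intro!: sum.cong)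
qed

lemma sum_path_weight:
  assumes "s \<in> \<Omega>"
  shows "(\<Sum>xs\<in>paths succs s k. path_weight (jump_prob q) xs) = 1"
proof (induction k)
  case (Suc k)
  have "(\<Sum>y\<in>succs (hd xs). jump_prob q (hd xs) y * 1) = 1" if "xs \<in> paths succs s k" for xs
  proof -
    have "hd xs \<in> \<Omega>" using paths_in[OF assms _ that] by simp
    then show ?thesis
      using sum_jump_prob[of "hd xs" "\<lambda>_. 1"] exit_rate_ge[of "hd xs"] qmin_pos
      by (simp add: exit_rate_eq)
  qed
  then show ?case
    using sum_weighted_paths_Suc[OF assms, where N = succs and k = k and g = "\<lambda>_. 1"] Suc by simp
qed simp

text \<open>Dividing the drift by the exit rate gives the mean change per jump. Jumps occur at rate
  at most \<open>qmax\<close>, so a loss of 1 per unit of time is a loss of at least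
  \<open>1 / qmax\<close> per jump.\<close>

lemma jump_drift_le:
  assumes "s \<in> \<Omega>" "drift q h s \<le> - 1"
  shows "(\<Sum>s'\<in>succs s. jump_prob q s s' * h s') \<le> h s - 1 / qmax"
proof -
  have pos: "0 < exit_rate q s" using exit_rate_ge[OF assms(1)] qmin_pos by simp
  have "drift q h s = (\<Sum>s'\<in>succs s. q s s' * h s') - exit_rate q s * h s"
    unfolding drift_def exit_rate_eq[OF assms(1)]
    by (simp add: algebra_simps sum_subtractf sum_distrib_left)
  then have "(\<Sum>s'\<in>succs s. q s s' * h s') \<le> exit_rate q s * h s - 1"
    using assms(2) by simp
  then have "(\<Sum>s'\<in>succs s. jump_prob q s s' * h s') \<le> h s - 1 / exit_rate q s"
    using pos unfolding sum_jump_prob[OF assms(1)] by (simp add: field_simps)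
  moreover have "1 / qmax \<le> 1 / exit_rate q s"
    using pos exit_rate_le[OF assms(1)] by (simp add: frac_le)
  ultimately show ?thesis by linarith
qed

section \<open>Mean number of jumps before a return\<close>

text \<open>The inner sum is the probability that the jump chain has not returned to
  \<open>s\<close> within \<open>l\<close> jumps, so the partial sums increase to the mean number of
  jumps until return. Each jump away from \<open>s\<close> costs \<open>h\<close> at least
  \<open>1 / qmax\<close> on average, and \<open>h\<close> cannot become negative.\<close>

lemma taboo_weights_bounded:
  assumes s: "s \<in> \<Omega>"
    and h0: "\<And>x. x \<in> \<Omega> \<Longrightarrow> 0 \<le> h x"
    and h: "\<And>x. x \<in> \<Omega> \<Longrightarrow> x \<noteq> s \<Longrightarrow> drift q h x \<le> - 1"
  shows "\<exists>C. \<forall>k. (\<Sum>l<k. \<Sum>xs\<in>paths (\<lambda>x. succs x - {s}) s l. path_weight (jump_prob q) xs) \<le> C"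
proof -
  define N where "N = (\<lambda>x. succs x - {s})"
  have N: "N x \<subseteq> succs x" for x by (auto simp: N_def)
  \<comment> \<open>\<open>a l\<close> is the probability of no return within \<open>l\<close>
    jumps, and \<open>b l\<close> is the expectation of \<open>h\<close> on that event.\<close>
  define a where "a l = (\<Sum>xs\<in>paths N s l. path_weight (jump_prob q) xs)" for l
  define b where "b l = (\<Sum>xs\<in>paths N s l. path_weight (jump_prob q) xs * h (hd xs))" for l
  have b0: "0 \<le> b l" for l
    unfolding b_def
    by (intro sum_nonneg mult_nonneg_nonneg path_weight_nonneg[OF s N] h0)
      (auto dest: paths_in[OF s N])
  \<comment> \<open>The recursion starts at index 1: the path without jumps ends in
    \<open>s\<close>, where the drift of \<open>h\<close> is not controlled.\<close>
  have step: "b (Suc (Suc l)) \<le> b (Suc l) - a (Suc l) / qmax" for l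
  proof -
    have "b (Suc (Suc l)) \<le>
       (\<Sum>xs\<in>paths N s (Suc l). path_weight (jump_prob q) xs * (h (hd xs) - 1 / qmax))"
      unfolding b_def sum_weighted_paths_Suc[OF s N]
    proof (intro sum_mono mult_left_mono path_weight_nonneg[OF s N])
      fix xs assume xs: "xs \<in> paths N s (Suc l)"
      have hd: "hd xs \<in> \<Omega>" using paths_in[OF s N xs] by simp
      have ne: "hd xs \<noteq> s" using xs by (auto simp: N_def)
      \<comment> \<open>Killing the paths that return to \<open>s\<close> only removes nonnegative
        terms.\<close>
      have "(\<Sum>y\<in>N (hd xs). jump_prob q (hd xs) y * h y) \<le>
          (\<Sum>y\<in>succs (hd xs). jump_prob q (hd xs) y * h y)"
        by (intro sum_mono2 finite_succ hd N mult_nonneg_nonneg jump_prob_nonneg h0)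
          (auto intro: succ_closed[OF hd])
      also have "\<dots> \<le> h (hd xs) - 1 / qmax"
        by (intro jump_drift_le hd h ne)
      finally show "(\<Sum>y\<in>N (hd xs). jump_prob q (hd xs) y * h y) \<le> h (hd xs) - 1 / qmax" .
    qed assumption
    also have "\<dots> = b (Suc l) - a (Suc l) / qmax"
      unfolding a_def b_def by (simp add: sum_subtractf algebra_simps sum_divide_distrib)
    finally show ?thesis .
  qed
  have tele: "(\<Sum>l<k. a (Suc l)) / qmax \<le> b 1 - b (Suc k)" for k
  proof (induction k)
    case (Suc k) then show ?case using step[of k] by (simp add: add_divide_distrib)
  qed simp
  have "(\<Sum>l<k. a l) \<le> 1 + qmax * b 1" for k
  proof (cases k)
    case 0 then show ?thesis using b0[of 1] qmax_pos[OF s] by simp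
  next
    case (Suc m)
    have "(\<Sum>l<m. a (Suc l)) / qmax \<le> b 1" using tele[of m] b0[of "Suc m"] by linarith
    then have "(\<Sum>l<m. a (Suc l)) \<le> qmax * b 1" using qmax_pos[OF s] by (simp add: field_simps)
    moreover have "a 0 = 1" by (simp add: a_def)
    moreover have "(\<Sum>l<k. a l) = a 0 + (\<Sum>l<m. a (Suc l))"
      unfolding Suc by (rule sum.lessThan_Suc_shift)
    ultimately show ?thesis by linarith
  qed
  then show ?thesis unfolding a_def N_def by blast
qed

text \<open>The killing argument tolerates a single exceptional state, the starting point, whereas a
  Lyapunov function usually leaves a finite set uncontrolled. Irreducibility closes the gap.\<close>

lemma drift_le_of_finite_exception:
  assumes s0: "s0 \<in> \<Omega>"
    and reach: "\<And>s. s \<in> \<Omega> \<Longrightarrow> (s, s0) \<in> {(a, b). a \<noteq> b \<and> 0 < q a b}\<^sup>*"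
    and V0: "\<And>s. s \<in> \<Omega> \<Longrightarrow> 0 \<le> V s"
    and F: "finite F"
    and V: "\<And>s. s \<in> \<Omega> - F \<Longrightarrow> drift q V s \<le> - 1"
  shows "\<exists>h. (\<forall>s\<in>\<Omega>. 0 \<le> h s) \<and> (\<forall>s\<in>\<Omega> - {s0}. drift q h s \<le> - 1)"
proof -
  define E where "E = {(a, b). a \<noteq> b \<and> 0 < q a b}"
  define d where "d s = (LEAST k. (s, s0) \<in> E ^^ k)" for s
  \<comment> \<open>Along a shortest path to \<open>s0\<close>, the function \<open>\<rho> ^ d\<close> has positive drift away from \<open>s0\<close>
    once \<open>\<rho>\<close> is smaller than the least transition probability; subtracting a large multiple of it
    repairs the drift of \<open>V\<close> on the finite set \<open>F\<close>.\<close>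
  define \<rho> where "\<rho> = qmin / (2 * qmax)"
  define \<phi> where "\<phi> s = \<rho> ^ d s" for s
  have qmax: "0 < qmax" using qmax_pos[OF s0] .
  have "qmin \<le> qmax" using exit_rate_ge[OF s0] exit_rate_le[OF s0] by linarith
  then have \<rho>: "0 < \<rho>" "\<rho> < 1" using qmin_pos qmax by (auto simp: \<rho>_def field_simps)
  have d: "(s, s0) \<in> E ^^ d s" if s: "s \<in> \<Omega>" for s
  proof -
    obtain k where "(s, s0) \<in> E ^^ k"
      using reach[OF s] unfolding E_def by (meson rtrancl_imp_relpow)
    then show ?thesis unfolding d_def by (rule LeastI)
  qed
  have \<phi>_drift: "\<rho> ^ d s * (qmin / (2 * \<rho>)) \<le> drift q \<phi> s" if s: "s \<in> \<Omega>" "s \<noteq> s0" for s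
  proof -
    obtain k where k: "d s = Suc k"
      using d[OF s(1)] s(2) by (cases "d s") auto
    then obtain y where y: "(s, y) \<in> E" "(y, s0) \<in> E ^^ k"
      using d[OF s(1)] by (metis relpow_Suc_D2)
    have "d y \<le> k" unfolding d_def by (rule Least_le) (rule y)
    then have \<phi>y: "\<rho> ^ k \<le> \<phi> y" unfolding \<phi>_def using \<rho> by (intro power_decreasing) auto
    have ys: "y \<in> succs s" using y(1) by (auto simp: E_def)
    \<comment> \<open>Since \<open>qmax * \<rho> = qmin / 2\<close>, the loss from leaving
      \<open>s\<close> uses up exactly half of the gain from the step towards
      \<open>s0\<close>.\<close>
    have "\<rho> ^ d s * (qmin / (2 * \<rho>)) = qmin * \<rho> ^ k - qmax * \<phi> s"
      using \<rho> qmax by (simp add: \<phi>_def k \<rho>_def field_simps)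
    also have "\<dots> \<le> q s y * \<phi> y - exit_rate q s * \<phi> s"
      using rate_ge[OF s(1), of y] ys \<phi>y exit_rate_le[OF s(1)] \<rho> qmin_pos qmax
      by (intro diff_mono mult_mono) (auto simp: \<phi>_def)
    also have "q s y * \<phi> y \<le> (\<Sum>s'\<in>succs s. q s s' * \<phi> s')"
      by (rule member_le_sum[where f = "\<lambda>s'. q s s' * \<phi> s'", OF ys _ finite_succ[OF s(1)]])
        (use rate_nonneg[OF s(1)] \<rho> in \<open>auto simp: \<phi>_def\<close>)
    also have "(\<Sum>s'\<in>succs s. q s s' * \<phi> s') - exit_rate q s * \<phi> s = drift q \<phi> s"
      unfolding drift_def exit_rate_eq[OF s(1)]
      by (simp add: algebra_simps sum_subtractf sum_distrib_left)
    finally show ?thesis by simp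
  qed
  obtain b where b: "0 \<le> b" "\<And>s. s \<in> F \<Longrightarrow> drift q V s \<le> b"
  proof
    show "0 \<le> (\<Sum>s\<in>F. \<bar>drift q V s\<bar>)" by (intro sum_nonneg) auto
    show "drift q V s \<le> (\<Sum>s\<in>F. \<bar>drift q V s\<bar>)" if "s \<in> F" for s
      using member_le_sum[OF that, of "\<lambda>s. \<bar>drift q V s\<bar>"] F by auto
  qed
  obtain m where m: "\<And>s. s \<in> F \<Longrightarrow> d s \<le> m"
    using F by (meson finite_imageI finite_nat_set_iff_bounded_le imageI)
  \<comment> \<open>On \<open>F\<close> the distance is at most \<open>m\<close>, so \<eta> bounds
    the drift of \<phi> from below there. The factor \<open>K\<close> is then chosen to outweigh the
    worst drift \<open>b\<close> of \<open>V\<close> by 1.\<close>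
  define \<eta> where "\<eta> = \<rho> ^ m * (qmin / (2 * \<rho>))"
  have \<eta>: "0 < \<eta>" using \<rho> qmin_pos by (simp add: \<eta>_def)
  define K where "K = (b + 1) / \<eta>"
  have K: "0 \<le> K" "K * \<eta> = b + 1" using \<eta> b by (auto simp: K_def)
  \<comment> \<open>The added constant \<open>K\<close> keeps \<open>h\<close> nonnegative, because
    \<phi> is at most 1.\<close>
  define h where "h s = V s + (K - K * \<phi> s)" for s
  have "0 \<le> h s" if "s \<in> \<Omega>" for s
  proof -
    have "\<phi> s \<le> 1" using \<rho> by (auto simp: \<phi>_def intro!: power_le_one)
    then have "K * \<phi> s \<le> K" using K by (simp add: mult_left_le)
    then show ?thesis using V0[OF that] by (simp add: h_def)
  qed
  moreover have "drift q h s \<le> - 1" if s: "s \<in> \<Omega> - {s0}" for s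
  proof -
    have h: "drift q h s = drift q V s - K * drift q \<phi> s"
      by (simp add: h_def[abs_def] drift_add drift_diff drift_const drift_cmult)
    have pos: "0 \<le> drift q \<phi> s"
      using s \<rho> qmin_pos by (intro order_trans[OF _ \<phi>_drift[of s]]) auto
    show ?thesis
    proof (cases "s \<in> F")
      case True
      have "\<eta> \<le> \<rho> ^ d s * (qmin / (2 * \<rho>))"
        unfolding \<eta>_def using \<rho> qmin_pos m[OF True] by (intro mult_right_mono power_decreasing) auto
      also have "\<dots> \<le> drift q \<phi> s" using \<phi>_drift s by auto
      finally have "K * \<eta> \<le> K * drift q \<phi> s" using K by (intro mult_left_mono)
      then show ?thesis using b(2)[OF True] K(2) h by linarith
    next
      case False
      then show ?thesis using V[of s] s h mult_nonneg_nonneg[OF K(1) pos] by auto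
    qed
  qed
  ultimately show ?thesis by blast
qed

section \<open>From the jump chain to the law in continuous time\<close>

text \<open>The return time is at most the total holding time before the chain is back in
  \<open>s\<close>. Its mean is estimated by summing, over the paths that have not returned, path
  weight times a uniform bound on the mean holding time. The condition on \<open>f\<close>
  guarantees that the image has really left \<open>f s\<close> in the meantime.\<close>

lemma nn_integral_return_time:
  assumes s: "s \<in> \<Omega>"
    and law: "jump_process_law q s M"
    and f: "\<And>s'. s' \<in> succs s \<Longrightarrow> f s' \<noteq> f s"
    and C: "\<And>k. (\<Sum>l<k. \<Sum>xs\<in>paths (\<lambda>x. succs x - {s}) s l. path_weight (jump_prob q) xs) \<le> C"
  shows "(\<integral>\<^sup>+\<omega>. return_time (\<lambda>t. f (state_at \<omega> t)) \<partial>M) < \<infinity>"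
proof -
  interpret prob_space M using law by (simp add: jump_process_law_def)
  have sets_M: "sets M = sets (\<Pi>\<^sub>M k\<in>UNIV. count_space UNIV \<Otimes>\<^sub>M (borel :: real measure))"
    using law by (simp add: jump_process_law_def)
  have space_M: "space M = UNIV"
    using sets_eq_imp_space_eq[OF sets_M] by (simp add: space_PiM space_pair_measure)
  note meas_M = measurable_cong_sets[OF sets_M refl]
  have [measurable]: "(\<lambda>\<omega>. fst (\<omega> i)) \<in> measurable M (count_space UNIV)"
    "(\<lambda>\<omega>. snd (\<omega> i)) \<in> borel_measurable M" for i
    unfolding meas_M by measurable
  \<comment> \<open>The law speaks only of events with strict lower bounds on holding times. The
    threshold is 0 before index \<open>k\<close>, which also provides the positivity needed to
    locate the jump times.\<close>
  define cyl where "cyl k xs t =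
    {\<omega> \<in> space M. (\<forall>i\<le>k. fst (\<omega> i) = rev xs ! i \<and> 0 < snd (\<omega> i)) \<and> t < snd (\<omega> k)}" for k xs t
  have cyl_sets [measurable]: "cyl k xs t \<in> sets M" for k xs t
  proof -
    have [measurable]: "Measurable.pred M (\<lambda>\<omega>. fst (\<omega> i) = y)" for i y
      using measurable_sets[of "\<lambda>\<omega>. fst (\<omega> i)" M "count_space UNIV" "{y}"]
      by (simp add: pred_def vimage_def Int_def conj_commute)
    show ?thesis unfolding cyl_def by measurable
  qed
  have cyl: "measure M (cyl k xs t) = path_weight (jump_prob q) xs * exp (- exit_rate q (hd xs) * t)"
    if xs: "xs \<in> paths N s k" and t: "0 \<le> t" for N k xs t
  proof -
    have len: "length xs = Suc k" using length_paths[OF xs] .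
    define hs where "hs i = (if i = k then t else 0)" for i
    have "cyl k xs t = {\<omega> \<in> space M. \<forall>i\<le>k. fst (\<omega> i) = rev xs ! i \<and> hs i < snd (\<omega> i)}"
    proof -
      have "(\<forall>i\<le>k. fst (\<omega> i) = rev xs ! i \<and> 0 < snd (\<omega> i)) \<and> t < snd (\<omega> k) \<longleftrightarrow>
          (\<forall>i\<le>k. fst (\<omega> i) = rev xs ! i \<and> hs i < snd (\<omega> i))" (is "?l \<longleftrightarrow> ?r")
        for \<omega> :: "'s trajectory"
      proof
        assume ?l then show ?r by (auto simp: hs_def)
      next
        assume r: ?r
        have "t < snd (\<omega> k)" using r by (auto simp: hs_def)
        moreover have "0 < snd (\<omega> i)" if "i \<le> k" for i
        proof -
          have "0 \<le> hs i" using t by (simp add: hs_def)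
          also have "hs i < snd (\<omega> i)" using r that by blast
          finally show ?thesis .
        qed
        ultimately show ?l using r by blast
      qed
      then show ?thesis by (simp add: cyl_def)
    qed
    moreover have "\<forall>i\<le>k. 0 \<le> hs i" using t by (auto simp: hs_def)
    moreover have "rev xs ! 0 = s" using last_paths[OF xs] len by (subst rev_nth_last) auto
    moreover have "(\<Prod>i\<le>k. exp (- exit_rate q (rev xs ! i) * hs i)) = exp (- exit_rate q (hd xs) * t)"
    proof -
      have "(\<Prod>i\<le>k. exp (- exit_rate q (rev xs ! i) * hs i)) =
          (\<Prod>i\<in>{k}. exp (- exit_rate q (rev xs ! i) * hs i))"
        by (intro prod.mono_neutral_right) (auto simp: hs_def)
      then show ?thesis by (simp add: rev_nth_hd[OF len] hs_def)
    qed
    ultimately show ?thesis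
      using law by (simp add: jump_process_law_def path_weight_eq_prod[OF len])
  qed
  \<comment> \<open>For each \<open>k\<close> the cylinders are disjoint and their weights add up to
    1. Hence almost every trajectory follows transitions of positive rate and has positive holding
    times.\<close>
  have good: "AE \<omega> in M. \<forall>k. \<exists>xs\<in>paths succs s k. \<omega> \<in> cyl k xs 0"
  proof (subst AE_all_countable, intro allI)
    fix k
    have disj: "disjoint_family_on (\<lambda>xs. cyl k xs 0) (paths succs s k)"
      unfolding disjoint_family_on_def
    proof (intro ballI impI)
      fix xs ys assume xs: "xs \<in> paths succs s k" and ys: "ys \<in> paths succs s k" and "xs \<noteq> ys"
      then have "rev xs \<noteq> rev ys" by simp
      then obtain i where "i \<le> k" "rev xs ! i \<noteq> rev ys ! i"
        using length_paths[OF xs] length_paths[OF ys] by (metis length_rev less_Suc_eq_le nth_equalityI)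
      then show "cyl k xs 0 \<inter> cyl k ys 0 = {}" by (auto simp: cyl_def)
    qed
    have fin: "finite (paths succs s k)" by (rule finite_paths[OF s]) simp
    have "prob (\<Union>xs\<in>paths succs s k. cyl k xs 0) = (\<Sum>xs\<in>paths succs s k. prob (cyl k xs 0))"
      by (rule finite_measure_finite_Union[OF fin _ disj]) auto
    also have "\<dots> = 1"
      using sum_path_weight[OF s, of k] by (simp add: cyl)
    finally have "AE \<omega> in M. \<omega> \<in> (\<Union>xs\<in>paths succs s k. cyl k xs 0)"
      by (subst (asm) prob_eq_1) (auto intro!: sets.finite_UN fin)
    then show "AE \<omega> in M. \<exists>xs\<in>paths succs s k. \<omega> \<in> cyl k xs 0" by eventually_elim auto
  qed
  define N where "N = (\<lambda>x. succs x - {s})"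
  have N: "N x \<subseteq> succs x" for x by (auto simp: N_def)
  note finN = finite_paths[OF s N]
  \<comment> \<open>The inner sum over \<open>m\<close> is the \<open>k\<close>-th holding time rounded up, hence at least 1: if the chain
    never returns, then \<open>g\<close> is infinite.\<close>
  define g :: "'s trajectory \<Rightarrow> ennreal" where
    "g \<omega> = (\<Sum>k. \<Sum>m. \<Sum>xs\<in>paths N s k. indicator (cyl k xs (real m)) \<omega>)" for \<omega>
  have bound: "return_time (\<lambda>t. f (state_at \<omega> t)) \<le> g \<omega>"
    if \<omega>: "\<And>k. \<exists>xs\<in>paths succs s k. \<omega> \<in> cyl k xs 0" for \<omega>
  proof -
    define Y T where "Y k = fst (\<omega> k)" and "T k = snd (\<omega> k)" for k
    have pos: "0 < T k" for k using \<omega>[of k] by (auto simp: cyl_def T_def)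
    have Y0: "Y 0 = s" using \<omega>[of 0] by (auto simp: cyl_def Y_def)
    have Y_succ: "Y (Suc k) \<in> succs (Y k)" for k
    proof -
      obtain xs where xs: "xs \<in> paths succs s (Suc k)" "\<omega> \<in> cyl (Suc k) xs 0" using \<omega> by blast
      then obtain ys y where ys: "ys \<in> paths succs s k" "xs = y # ys" "y \<in> succs (hd ys)" by auto
      have len: "length ys = Suc k" using length_paths[OF ys(1)] .
      have "Y (Suc k) = rev xs ! Suc k" "Y k = rev xs ! k"
        using xs(2) by (auto simp: cyl_def Y_def)
      then have "Y (Suc k) = y" "Y k = hd ys"
        using len rev_nth_hd[OF len] by (auto simp: ys(2) nth_append)
      then show ?thesis using ys(3) by simp
    qed
    have path: "\<exists>xs\<in>paths N s k. hd xs = Y k \<and> (\<forall>i\<le>k. Y i = rev xs ! i)"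
      if "\<forall>i\<in>{1..k}. Y i \<noteq> s" for k
      using that
    proof (induction k)
      case 0 then show ?case using Y0 by auto
    next
      case (Suc k)
      then obtain xs where xs: "xs \<in> paths N s k" "hd xs = Y k" "\<forall>i\<le>k. Y i = rev xs ! i" by auto
      have "Y (Suc k) # xs \<in> paths N s (Suc k)"
        using xs Y_succ[of k] Suc.prems by (auto simp: N_def intro!: bexI[of _ xs])
      moreover have "\<forall>i\<le>Suc k. Y i = rev (Y (Suc k) # xs) ! i"
        using xs length_paths[OF xs(1)] by (auto simp: nth_append le_Suc_eq)
      ultimately show ?case by (metis list.sel(1))
    qed
    have in_cyl: "\<exists>xs\<in>paths N s k. \<omega> \<in> cyl k xs t" if k: "\<forall>i\<in>{1..k}. Y i \<noteq> s" "t < T k" for k t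
    proof -
      obtain xs where "xs \<in> paths N s k" "\<forall>i\<le>k. Y i = rev xs ! i" using path[OF k(1)] by blast
      then show ?thesis
        using k(2) pos by (intro bexI[of _ xs]) (auto simp: cyl_def space_M Y_def T_def)
    qed
    have term_ge: "1 \<le> (\<Sum>xs\<in>paths N s k. indicator (cyl k xs (real m)) \<omega> :: ennreal)"
      if k: "\<forall>i\<in>{1..k}. Y i \<noteq> s" "real m < T k" for k m
    proof -
      obtain xs where xs: "xs \<in> paths N s k" "\<omega> \<in> cyl k xs (real m)" using in_cyl[OF k] by blast
      have "(indicator (cyl k xs (real m)) \<omega> :: ennreal) \<le>
          (\<Sum>xs\<in>paths N s k. indicator (cyl k xs (real m)) \<omega>)"
        by (intro member_le_sum xs finN) auto
      then show ?thesis using xs by simp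
    qed
    have inner_ge: "ennreal (T k) \<le> (\<Sum>m. \<Sum>xs\<in>paths N s k. indicator (cyl k xs (real m)) \<omega>)"
      if "\<forall>i\<in>{1..k}. Y i \<noteq> s" for k
    proof -
      define l where "l = nat \<lceil>T k\<rceil>"
      have "real m < T k" if "m < l" for m using that by (simp add: l_def) linarith
      then have "(\<Sum>m<l. 1) \<le> (\<Sum>m<l. \<Sum>xs\<in>paths N s k. indicator (cyl k xs (real m)) \<omega> :: ennreal)"
        by (intro sum_mono term_ge that) auto
      also have "\<dots> \<le> (\<Sum>m. \<Sum>xs\<in>paths N s k. indicator (cyl k xs (real m)) \<omega>)"
        by (intro sum_le_suminf) auto
      finally have "of_nat l \<le> (\<Sum>m. \<Sum>xs\<in>paths N s k. indicator (cyl k xs (real m)) \<omega> :: ennreal)"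
        by simp
      moreover have "ennreal (T k) \<le> of_nat l"
        using pos[of k] by (simp add: l_def ennreal_of_nat_eq_real_of_nat)
      ultimately show ?thesis by (rule order_trans[rotated])
    qed
    show ?thesis
    proof (cases "\<exists>k\<ge>1. Y k = s")
      case True
      define k where "k = (LEAST k. 1 \<le> k \<and> Y k = s)"
      have k: "1 \<le> k" "Y k = s" using LeastI_ex[OF True[unfolded Bex_def]] by (auto simp: k_def)
      have before: "Y i \<noteq> s" if "1 \<le> i" "i < k" for i
        using not_less_Least[of i "\<lambda>k. 1 \<le> k \<and> Y k = s"] that by (auto simp: k_def)
      \<comment> \<open>The strict inequality in \<open>state_at\<close> makes trajectories
        right-continuous, so at the jump time itself the new state is already in force.\<close>
      have at_jump: "state_at \<omega> (\<Sum>i<j. T i) = Y j" for j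
      proof -
        have "(LEAST k. (\<Sum>i<j. T i) < (\<Sum>i\<le>k. snd (\<omega> i))) = j"
        proof (rule Least_equality)
          show "(\<Sum>i<j. T i) < (\<Sum>i\<le>j. snd (\<omega> i))"
            using pos[of j] by (simp add: T_def lessThan_Suc_atMost[symmetric])
          show "j \<le> l" if "(\<Sum>i<j. T i) < (\<Sum>i\<le>l. snd (\<omega> i))" for l
          proof (rule ccontr)
            assume "\<not> j \<le> l"
            then have "(\<Sum>i\<le>l. T i) \<le> (\<Sum>i<j. T i)"
              by (intro sum_mono2) (auto intro: less_imp_le[OF pos])
            then show False using that by (simp add: T_def)
          qed
        qed
        then show ?thesis by (simp add: state_at_def Y_def)
      qed
      have X0: "state_at \<omega> 0 = s" using at_jump[of 0] Y0 by simp
      have X1: "state_at \<omega> (T 0) = Y 1" using at_jump[of 1] by simp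
      \<comment> \<open>The image has changed at time \<open>T 0\<close>, which is the witness
        \<open>u\<close> required by \<open>return_time\<close>. It also rules out a return at the
        first jump, so the return comes strictly later than \<open>T 0\<close>.\<close>
      have f1: "f (Y 1) \<noteq> f s" using f Y_succ[of 0] Y0 by simp
      have "k \<noteq> 1" using k f1 by auto
      then have "T 0 < (\<Sum>i<k. T i)"
      proof -
        have "(\<Sum>i<Suc (Suc 0). T i) \<le> (\<Sum>i<k. T i)"
          using k(1) \<open>k \<noteq> 1\<close> by (intro sum_mono2) (auto intro: less_imp_le[OF pos])
        then show ?thesis using pos[of 1] by simp
      qed
      then have "return_time (\<lambda>t. f (state_at \<omega> t)) \<le> ennreal (\<Sum>i<k. T i)"
        unfolding return_time_def
        using at_jump[of k] X0 X1 f1 k less_imp_le[OF pos[of 0]]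
        by (intro INF_lower) (auto intro!: exI[of _ "T 0"])
      also have "\<dots> = (\<Sum>i<k. ennreal (T i))"
        using pos by (subst sum_ennreal) (auto intro: less_imp_le)
      also have "\<dots> \<le> (\<Sum>j<k. \<Sum>m. \<Sum>xs\<in>paths N s j. indicator (cyl j xs (real m)) \<omega>)"
        using before by (intro sum_mono inner_ge) auto
      also have "\<dots> \<le> g \<omega>"
        unfolding g_def by (intro sum_le_suminf) auto
      finally show ?thesis .
    next
      case False
      have "of_nat l \<le> g \<omega>" for l :: nat
      proof -
        have "(\<Sum>k<l. 1) \<le> (\<Sum>k<l. \<Sum>m. \<Sum>xs\<in>paths N s k. indicator (cyl k xs (real m)) \<omega> :: ennreal)"
        proof (rule sum_mono)
          fix k
          have "1 \<le> (\<Sum>m<1. \<Sum>xs\<in>paths N s k. indicator (cyl k xs (real m)) \<omega> :: ennreal)"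
            using term_ge[of k 0] False pos[of k] by auto
          also have "\<dots> \<le> (\<Sum>m. \<Sum>xs\<in>paths N s k. indicator (cyl k xs (real m)) \<omega>)"
            by (intro sum_le_suminf) auto
          finally show "1 \<le> (\<Sum>m. \<Sum>xs\<in>paths N s k. indicator (cyl k xs (real m)) \<omega> :: ennreal)" .
        qed
        also have "\<dots> \<le> g \<omega>"
          unfolding g_def by (intro sum_le_suminf) auto
        finally show ?thesis by simp
      qed
      then have "g \<omega> = top"
        by (meson ennreal_Ex_less_of_nat leD top.not_eq_extremum)
      then show ?thesis by simp
    qed
  qed
  \<comment> \<open>The geometric series of \<open>exp (- qmin)\<close>: it bounds the mean of a
    rounded-up holding time, whose rate is at least \<open>qmin\<close>.\<close>
  define c where "c = 1 / (1 - exp (- qmin))"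
  have c: "0 \<le> c" using qmin_pos by (simp add: c_def)
  have inner: "(\<Sum>m. emeasure M (cyl k xs (real m))) \<le> ennreal (path_weight (jump_prob q) xs * c)"
    if xs: "xs \<in> paths N s k" for k xs
  proof -
    have w: "0 \<le> path_weight (jump_prob q) xs" by (rule path_weight_nonneg[OF s N xs])
    have hd: "hd xs \<in> \<Omega>" using paths_in[OF s N xs] by simp
    have "emeasure M (cyl k xs (real m)) \<le> ennreal (path_weight (jump_prob q) xs * exp (- qmin) ^ m)" for m
      unfolding emeasure_eq_measure cyl[OF xs of_nat_0_le_iff]
      using w exit_rate_ge[OF hd]
      by (intro ennreal_leI mult_left_mono)
        (auto simp: exp_of_nat_mult[symmetric] mult.commute[of "real m"] intro!: mult_right_mono)
    then have "(\<Sum>m. emeasure M (cyl k xs (real m))) \<le>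
        (\<Sum>m. ennreal (path_weight (jump_prob q) xs * exp (- qmin) ^ m))"
      by (intro suminf_le) auto
    also have "\<dots> = ennreal (\<Sum>m. path_weight (jump_prob q) xs * exp (- qmin) ^ m)"
      using w qmin_pos by (intro suminf_ennreal2) (auto intro!: summable_mult summable_geometric)
    also have "(\<Sum>m. path_weight (jump_prob q) xs * exp (- qmin) ^ m) = path_weight (jump_prob q) xs * c"
      using qmin_pos by (subst suminf_mult) (auto intro!: summable_geometric simp: suminf_geometric c_def)
    finally show ?thesis .
  qed
  have "(\<integral>\<^sup>+\<omega>. return_time (\<lambda>t. f (state_at \<omega> t)) \<partial>M) \<le> (\<integral>\<^sup>+\<omega>. g \<omega> \<partial>M)"
  proof (rule nn_integral_mono_AE)
    \<comment> \<open>An upper bound of a nonnegative integral needs no measurability of the smaller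
      function, so \<open>return_time\<close> is only compared with the measurable
      \<open>g\<close>.\<close>
    show "AE \<omega> in M. return_time (\<lambda>t. f (state_at \<omega> t)) \<le> g \<omega>"
      using good by eventually_elim (rule bound, blast)
  qed
  also have "\<dots> = (\<Sum>k. \<Sum>m. \<Sum>xs\<in>paths N s k. emeasure M (cyl k xs (real m)))"
    unfolding g_def by (simp add: nn_integral_suminf nn_integral_sum)
  also have "\<dots> = (\<Sum>k. \<Sum>xs\<in>paths N s k. \<Sum>m. emeasure M (cyl k xs (real m)))"
    by (intro suminf_cong) (simp add: suminf_sum)
  also have "\<dots> \<le> ennreal (C * c)"
  proof (rule suminf_le_const)
    fix k
    have "(\<Sum>l<k. \<Sum>xs\<in>paths N s l. \<Sum>m. emeasure M (cyl l xs (real m))) \<le>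
        (\<Sum>l<k. \<Sum>xs\<in>paths N s l. ennreal (path_weight (jump_prob q) xs * c))"
      by (intro sum_mono inner)
    also have "\<dots> = ennreal (\<Sum>l<k. \<Sum>xs\<in>paths N s l. path_weight (jump_prob q) xs * c)"
    proof -
      have w: "0 \<le> path_weight (jump_prob q) xs * c" if "xs \<in> paths N s l" for l xs
        using path_weight_nonneg[OF s N that] c by simp
      have "(\<Sum>xs\<in>paths N s l. ennreal (path_weight (jump_prob q) xs * c)) =
          ennreal (\<Sum>xs\<in>paths N s l. path_weight (jump_prob q) xs * c)" for l
        using w by (rule sum_ennreal)
      moreover have "(\<Sum>l<k. ennreal (\<Sum>xs\<in>paths N s l. path_weight (jump_prob q) xs * c)) =
          ennreal (\<Sum>l<k. \<Sum>xs\<in>paths N s l. path_weight (jump_prob q) xs * c)"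
        by (intro sum_ennreal sum_nonneg w)
      ultimately show ?thesis by simp
    qed
    also have "(\<Sum>l<k. \<Sum>xs\<in>paths N s l. path_weight (jump_prob q) xs * c) =
        (\<Sum>l<k. \<Sum>xs\<in>paths N s l. path_weight (jump_prob q) xs) * c"
      by (simp add: sum_distrib_right)
    also have "\<dots> \<le> C * c" using C[of k] c by (intro mult_right_mono) (auto simp: N_def)
    finally show "(\<Sum>l<k. \<Sum>xs\<in>paths N s l. \<Sum>m. emeasure M (cyl l xs (real m))) \<le> ennreal (C * c)"
      by (simp add: ennreal_leI)
  qed simp
  finally show ?thesis by (simp add: order_le_less_trans)
qed

theorem positive_recurrent_image_Foster:
  assumes reach: "\<And>s s'. s \<in> \<Omega> \<Longrightarrow> s' \<in> \<Omega> \<Longrightarrow> (s, s') \<in> {(a, b). a \<noteq> b \<and> 0 < q a b}\<^sup>*"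
    and V0: "\<And>s. s \<in> \<Omega> \<Longrightarrow> 0 \<le> V s"
    and F: "finite F"
    and V: "\<And>s. s \<in> \<Omega> - F \<Longrightarrow> drift q V s \<le> - 1"
    and f: "\<And>s s'. s \<in> \<Omega> \<Longrightarrow> s' \<in> succs s \<Longrightarrow> f s' \<noteq> f s"
  shows "positive_recurrent_image q \<Omega> f"
  unfolding positive_recurrent_image_def
proof (intro ballI allI impI)
  fix s M assume s: "s \<in> \<Omega>" and law: "jump_process_law q s M"
  obtain h where "\<forall>x\<in>\<Omega>. 0 \<le> h x" "\<forall>x\<in>\<Omega> - {s}. drift q h x \<le> - 1"
    using drift_le_of_finite_exception[OF s reach[OF _ s] V0 F V] by blast
  then obtain C where "\<And>k. (\<Sum>l<k. \<Sum>xs\<in>paths (\<lambda>x. succs x - {s}) s l. path_weight (jump_prob q) xs) \<le> C"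
    using taboo_weights_bounded[OF s, of h] by auto
  then show "(\<integral>\<^sup>+\<omega>. return_time (\<lambda>t. f (state_at \<omega> t)) \<partial>M) < \<infinity>"
    using nn_integral_return_time[OF s law, of f C] f[OF s] by blast
qed

end

subsection \<open>The PULL-2 network\<close>

text \<open>Rates are attached to labels, and several labels can lead to the same state: a departure
  that leaves customers behind is the same for every router. Integrating against the labels accounts
  for these multiplicities.\<close>

lemma sum_family_of_bool:
  fixes c d :: "_ \<Rightarrow> real"
  assumes "finite T" "t ` A \<subseteq> T"
  shows "(\<Sum>x\<in>T. (\<Sum>a\<in>A. c a * of_bool (x = t a)) * d x) = (\<Sum>a\<in>A. c a * d (t a))"
proof -
  have "(\<Sum>x\<in>T. (\<Sum>a\<in>A. c a * of_bool (x = t a)) * d x) =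
      (\<Sum>x\<in>T. \<Sum>a\<in>A. if x = t a then c a * d (t a) else 0)"
    unfolding sum_distrib_right by (intro sum.cong) auto
  also have "\<dots> = (\<Sum>a\<in>A. \<Sum>x\<in>T. if x = t a then c a * d (t a) else 0)"
    by (rule sum.swap)
  also have "\<dots> = (\<Sum>a\<in>A. c a * d (t a))"
    using assms by (intro sum.cong) auto
  finally show ?thesis .
qed

lemma sum_fun_upd:
  fixes g :: "'b \<Rightarrow> real"
  assumes "finite A" "i \<in> A"
  shows "(\<Sum>j\<in>A. g ((f(i := x)) j)) = (\<Sum>j\<in>A. g (f j)) + (g x - g (f i))"
  using assms by (subst (1 2) sum.remove[of A i]) (auto intro!: sum.cong)

section \<open>Transitions of PULL-2 and their rates\<close>

text \<open>The real parameters stay fixed while the number of servers grows, so bounds in terms of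
  them and the number of routers are uniform in the scaling. \<delta> is the spare capacity per
  server.\<close>

locale pull_network =
  fixes P :: pull_system and mumin mumax lam \<delta> :: real
  assumes routers: "1 \<le> num_routers P"
    and buffer_ge: "i \<in> servers P \<Longrightarrow> 1 \<le> buffer P (fst i)"
    and servers_nonempty: "servers P \<noteq> {}"
    and mumin_pos: "0 < mumin"
    and mumin_le: "i \<in> servers P \<Longrightarrow> mumin \<le> service_rate P (fst i)"
    and le_mumax: "i \<in> servers P \<Longrightarrow> service_rate P (fst i) \<le> mumax"
    and lam_pos: "0 < lam"
    and \<delta>_pos: "0 < \<delta>"
    and arrival: "arrival_rate P = lam * real (card (servers P))"
    and capacity: "(\<Sum>i\<in>servers P. service_rate P (fst i)) = (lam + \<delta>) * real (card (servers P))"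
begin

abbreviation I :: "server set" where "I \<equiv> servers P"
abbreviation R :: nat where "R \<equiv> num_routers P"
abbreviation n :: nat where "n \<equiv> card I"
abbreviation mu :: "server \<Rightarrow> real" where "mu i \<equiv> service_rate P (fst i)"
abbreviation open_servers :: "pull_state \<Rightarrow> server set" where
  "open_servers S \<equiv> {i. i \<in> I \<and> enat (fst S i) < buffer P (fst i)}"
abbreviation busy :: "pull_state \<Rightarrow> server set" where
  "busy S \<equiv> {i. i \<in> I \<and> 0 < fst S i}"
abbreviation idle :: "pull_state \<Rightarrow> server set" where
  "idle S \<equiv> {i. i \<in> I \<and> fst S i = 0}"

definition msgs :: "pull_state \<Rightarrow> nat \<Rightarrow> real" where
  "msgs S r = real (card {i \<in> I. snd S i = r})"

definition empty_frac :: "pull_state \<Rightarrow> real" where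
  "empty_frac S = real (card {r \<in> {1..R}. {i \<in> I. snd S i = r} = {}}) / real R"

text \<open>Counts all customers sent to the server, before any blocking; blocking enters only
  through \<open>open_servers\<close>.\<close>

definition join_rate :: "pull_state \<Rightarrow> server \<Rightarrow> real" where
  "join_rate S i = arrival_rate P / real R * (\<Sum>r = 1..R. routing_prob P S r i)"

lemma finite_I [simp]: "finite I"
  by (auto simp: servers_def)

lemma n_pos: "0 < real n"
  using servers_nonempty by (simp add: card_gt_0_iff)

lemma R_pos: "0 < real R"
  using routers by simp

lemma mu_pos: "i \<in> I \<Longrightarrow> 0 < mu i"
  using mumin_le mumin_pos by fastforce

lemma service_rate_nonneg: "(j, k) \<in> I \<Longrightarrow> 0 \<le> service_rate P j"
  using mu_pos[of "(j, k)"] by simp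

lemma mumax_pos: "0 < mumax"
  using servers_nonempty le_mumax mu_pos by fastforce

lemma arrival_pos: "0 < arrival_rate P"
  using lam_pos n_pos by (simp add: arrival)

lemma routing_prob_nonneg: "0 \<le> routing_prob P S r i"
  by (auto simp: routing_prob_def Let_def split: prod.splits)

lemma routing_prob_le: "routing_prob P S r i \<le> 1"
proof -
  have "1 / real (card A) \<le> 1" for A :: "server set"
    by (cases "card A = 0") auto
  then show ?thesis by (auto simp: routing_prob_def Let_def split: prod.splits)
qed

lemma routing_prob_ge:
  assumes "0 < routing_prob P S r i"
  shows "1 / real n \<le> routing_prob P S r i"
proof -
  have "1 / real n \<le> 1 / real (card A)" if "A \<subseteq> I" "A \<noteq> {}" for A
    using that n_pos by (intro divide_left_mono) (auto intro!: card_mono mult_pos_pos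
        simp: card_gt_0_iff intro: finite_subset[OF _ finite_I])
  then show ?thesis using assms
    by (auto simp: routing_prob_def Let_def split: prod.splits if_splits)
qed

lemma join_rate_nonneg: "0 \<le> join_rate S i"
  unfolding join_rate_def using arrival_pos R_pos
  by (intro mult_nonneg_nonneg sum_nonneg routing_prob_nonneg) auto

lemma join_rate_le: "join_rate S i \<le> arrival_rate P"
proof -
  have "(\<Sum>r = 1..R. routing_prob P S r i) \<le> (\<Sum>r = 1..R. 1)"
    by (intro sum_mono routing_prob_le)
  then have "join_rate S i \<le> arrival_rate P / real R * real R"
    unfolding join_rate_def using arrival_pos by (intro mult_left_mono) auto
  then show ?thesis using R_pos by simp
qed

lemma pull2_rate_eq:
  "pull2_rate P S S' = (\<Sum>i\<in>open_servers S. join_rate S i * of_bool (S' = arrive i S)) +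
     (\<Sum>(i, r)\<in>busy S \<times> {1..R}. mu i / real R * of_bool (S' = depart i r S))"
proof -
  have "(\<Sum>r = 1..R. \<Sum>i\<in>open_servers S. arrival_rate P / real R * routing_prob P S r i
          * of_bool (S' = arrive i S)) =
        (\<Sum>i\<in>open_servers S. \<Sum>r = 1..R. arrival_rate P / real R * routing_prob P S r i
          * of_bool (S' = arrive i S))"
    by (rule sum.swap)
  also have "\<dots> = (\<Sum>i\<in>open_servers S. join_rate S i * of_bool (S' = arrive i S))"
    unfolding join_rate_def sum_distrib_left sum_distrib_right by (simp add: mult.assoc)
  finally show ?thesis
    unfolding pull2_rate_def by (simp add: sum.cartesian_product)
qed

lemma pull2_rate_nonneg: "0 \<le> pull2_rate P S S'"
  unfolding pull2_rate_eq using R_pos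
  by (intro add_nonneg_nonneg sum_nonneg) (auto simp: join_rate_nonneg service_rate_nonneg)

lemma join_rate_le_rate:
  assumes "i \<in> open_servers S"
  shows "join_rate S i \<le> pull2_rate P S (arrive i S)"
proof -
  have "join_rate S i * of_bool (arrive i S = arrive i S) \<le>
      (\<Sum>j\<in>open_servers S. join_rate S j * of_bool (arrive i S = arrive j S))"
    by (rule member_le_sum[OF assms]) (auto intro!: mult_nonneg_nonneg join_rate_nonneg)
  moreover have "0 \<le> (\<Sum>(j, r)\<in>busy S \<times> {1..R}. mu j / real R * of_bool (arrive i S = depart j r S))"
    by (intro sum_nonneg) (auto simp: service_rate_nonneg)
  ultimately show ?thesis unfolding pull2_rate_eq by simp
qed

lemma mu_le_rate:
  assumes "i \<in> busy S" "r \<in> {1..R}"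
  shows "mu i / real R \<le> pull2_rate P S (depart i r S)"
proof -
  have "(case (i, r) of (j, r') \<Rightarrow> mu j / real R * of_bool (depart i r S = depart j r' S)) \<le>
      (\<Sum>(j, r')\<in>busy S \<times> {1..R}. mu j / real R * of_bool (depart i r S = depart j r' S))"
    by (rule member_le_sum[where i = "(i, r)"])
      (use assms in \<open>auto simp: service_rate_nonneg\<close>)
  moreover have "0 \<le> (\<Sum>j\<in>open_servers S. join_rate S j * of_bool (depart i r S = arrive j S))"
    by (intro sum_nonneg) (auto intro!: mult_nonneg_nonneg join_rate_nonneg)
  ultimately show ?thesis unfolding pull2_rate_eq by simp
qed

lemma pull2_rate_cases:
  assumes "0 < pull2_rate P S S'"
  obtains (arrive) i where "i \<in> open_servers S" "0 < join_rate S i" "S' = arrive i S"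
    | (depart) i r where "i \<in> busy S" "r \<in> {1..R}" "S' = depart i r S"
proof (rule ccontr)
  assume c: "\<not> thesis"
  have "join_rate S i * of_bool (S' = arrive i S) = 0" if "i \<in> open_servers S" for i
    using arrive[OF that] c join_rate_nonneg[of S i] by force
  moreover have "mu i / real R * of_bool (S' = depart i r S) = 0" if "i \<in> busy S" "r \<in> {1..R}" for i r
    using depart[OF that] c by auto
  ultimately have "(\<Sum>i\<in>open_servers S. join_rate S i * of_bool (S' = arrive i S)) = 0"
    "(\<Sum>a\<in>busy S \<times> {1..R}. case a of (i, r) \<Rightarrow> mu i / real R * of_bool (S' = depart i r S)) = 0"
    by (intro sum.neutral; force)+
  then have "pull2_rate P S S' = 0" unfolding pull2_rate_eq by simp
  then show False using assms by simp
qed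

lemma arrive_neq: "arrive i S \<noteq> S"
proof
  assume "arrive i S = S"
  then have "fst (arrive i S) i = fst S i" by simp
  then show False by (simp add: arrive_def split: prod.splits)
qed

lemma depart_neq: "0 < fst S i \<Longrightarrow> depart i r S \<noteq> S"
proof
  assume "0 < fst S i" "depart i r S = S"
  then have "fst (depart i r S) i = fst S i" by simp
  then show False using \<open>0 < fst S i\<close> by (simp add: depart_def split: prod.splits)
qed

lemma succs_subset:
  "{S'. S' \<noteq> S \<and> 0 < pull2_rate P S S'} \<subseteq>
     (\<lambda>i. arrive i S) ` open_servers S \<union> (\<lambda>(i, r). depart i r S) ` (busy S \<times> {1..R})"
proof
  fix S' assume "S' \<in> {S'. S' \<noteq> S \<and> 0 < pull2_rate P S S'}"
  then have "0 < pull2_rate P S S'" by simp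
  then show "S' \<in> (\<lambda>i. arrive i S) ` open_servers S \<union> (\<lambda>(i, r). depart i r S) ` (busy S \<times> {1..R})"
  proof (cases rule: pull2_rate_cases)
    case (arrive i) then show ?thesis by blast
  next
    case (depart i r)
    then have "S' = (case (i, r) of (i, r) \<Rightarrow> depart i r S)" "(i, r) \<in> busy S \<times> {1..R}" by auto
    then show ?thesis by blast
  qed
qed

lemma finite_succs: "finite {S'. S' \<noteq> S \<and> 0 < pull2_rate P S S'}"
  by (rule finite_subset[OF succs_subset]) auto

text \<open>No arrival and no departure leads back to \<open>S\<close>, so excluding the diagonal
  loses nothing and the sum over target states becomes a sum over labels.\<close>

lemma sum_succs:
  "(\<Sum>S' | S' \<noteq> S \<and> 0 < pull2_rate P S S'. pull2_rate P S S' * k S') =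
     (\<Sum>i\<in>open_servers S. join_rate S i * k (arrive i S)) +
     (\<Sum>i\<in>busy S. \<Sum>r = 1..R. mu i / real R * k (depart i r S))"
proof -
  define T where "T = (\<lambda>i. arrive i S) ` open_servers S \<union> (\<lambda>(i, r). depart i r S) ` (busy S \<times> {1..R})"
  have T: "finite T" by (simp add: T_def)
  have "(\<Sum>S' | S' \<noteq> S \<and> 0 < pull2_rate P S S'. pull2_rate P S S' * k S') =
      (\<Sum>S'\<in>T. pull2_rate P S S' * k S')"
  proof (rule sum.mono_neutral_left[OF T])
    show "{S'. S' \<noteq> S \<and> 0 < pull2_rate P S S'} \<subseteq> T"
      unfolding T_def by (rule succs_subset)
    show "\<forall>S'\<in>T - {S'. S' \<noteq> S \<and> 0 < pull2_rate P S S'}. pull2_rate P S S' * k S' = 0"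
    proof
      fix S' assume S': "S' \<in> T - {S'. S' \<noteq> S \<and> 0 < pull2_rate P S S'}"
      have "S \<notin> T"
        unfolding T_def Un_iff image_iff
        using arrive_neq[of _ S, symmetric] depart_neq[of S, symmetric] by fastforce
      then have "S' \<noteq> S" using S' by blast
      then show "pull2_rate P S S' * k S' = 0" using S' pull2_rate_nonneg[of S S'] by auto
    qed
  qed
  also have "\<dots> = (\<Sum>i\<in>open_servers S. join_rate S i * k (arrive i S)) +
      (\<Sum>a\<in>busy S \<times> {1..R}. (case a of (i, r) \<Rightarrow> mu i / real R) * k (case a of (i, r) \<Rightarrow> depart i r S))"
  proof -
    have "(\<Sum>S'\<in>T. (\<Sum>i\<in>open_servers S. join_rate S i * of_bool (S' = arrive i S)) * k S') =
        (\<Sum>i\<in>open_servers S. join_rate S i * k (arrive i S))"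
      by (rule sum_family_of_bool[OF T]) (auto simp: T_def)
    moreover have "(\<Sum>S'\<in>T. (\<Sum>a\<in>busy S \<times> {1..R}. (case a of (i, r) \<Rightarrow> mu i / real R) *
          of_bool (S' = (case a of (i, r) \<Rightarrow> depart i r S))) * k S') =
        (\<Sum>a\<in>busy S \<times> {1..R}. (case a of (i, r) \<Rightarrow> mu i / real R) * k (case a of (i, r) \<Rightarrow> depart i r S))"
      by (rule sum_family_of_bool[OF T]) (auto simp: T_def)
    ultimately show ?thesis
      unfolding pull2_rate_eq by (simp add: distrib_right sum.distrib case_prod_unfold)
  qed
  finally show ?thesis by (simp add: sum.cartesian_product case_prod_unfold)
qed

lemma drift_pull2:
  "drift (pull2_rate P) g S =
     (\<Sum>i\<in>open_servers S. join_rate S i * (g (arrive i S) - g S)) +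
     (\<Sum>i\<in>busy S. \<Sum>r = 1..R. mu i / real R * (g (depart i r S) - g S))"
  unfolding drift_def by (rule sum_succs)

lemma sum_rates_le:
  "(\<Sum>S' | S' \<noteq> S \<and> 0 < pull2_rate P S S'. pull2_rate P S S') \<le>
     real n * arrival_rate P + (\<Sum>i\<in>I. mu i)"
proof -
  have "(\<Sum>S' | S' \<noteq> S \<and> 0 < pull2_rate P S S'. pull2_rate P S S') =
      (\<Sum>i\<in>open_servers S. join_rate S i) + (\<Sum>i\<in>busy S. mu i)"
    using sum_succs[of S "\<lambda>_. 1"] R_pos by simp
  also have "(\<Sum>i\<in>open_servers S. join_rate S i) \<le> (\<Sum>i\<in>I. join_rate S i)"
    by (intro sum_mono2) (auto simp: join_rate_nonneg)
  also have "\<dots> \<le> (\<Sum>i\<in>I. arrival_rate P)" by (intro sum_mono join_rate_le)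
  also have "(\<Sum>i\<in>busy S. mu i) \<le> (\<Sum>i\<in>I. mu i)"
    by (intro sum_mono2) (auto intro: less_imp_le[OF mu_pos])
  finally show ?thesis by simp
qed

lemma pull_statesD:
  assumes "S \<in> pull_states P"
  shows "i \<in> I \<Longrightarrow> fst S i = 0 \<Longrightarrow> snd S i \<in> {1..R}"
    and "i \<in> I \<Longrightarrow> 0 < fst S i \<Longrightarrow> snd S i = 0"
    and "i \<in> I \<Longrightarrow> enat (fst S i) \<le> buffer P (fst i)"
    and "i \<notin> I \<Longrightarrow> fst S i = 0" "i \<notin> I \<Longrightarrow> snd S i = 0"
proof -
  obtain Q D where S: "S = (Q, D)" by (cases S)
  note * = assms[unfolded S pull_states_def mem_Collect_eq prod.case]
  have "i \<in> I \<Longrightarrow> enat (Q i) \<le> buffer P (fst i) \<and> (if Q i = 0 then D i \<in> {1..R} else D i = 0)"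
    "i \<notin> I \<Longrightarrow> Q i = 0 \<and> D i = 0"
    using * by blast+
  then show "i \<in> I \<Longrightarrow> fst S i = 0 \<Longrightarrow> snd S i \<in> {1..R}"
    "i \<in> I \<Longrightarrow> 0 < fst S i \<Longrightarrow> snd S i = 0"
    "i \<in> I \<Longrightarrow> enat (fst S i) \<le> buffer P (fst i)"
    "i \<notin> I \<Longrightarrow> fst S i = 0" "i \<notin> I \<Longrightarrow> snd S i = 0"
    by (simp_all add: S)
qed

lemma idle_open: "i \<in> idle S \<Longrightarrow> i \<in> open_servers S"
  using buffer_ge[of i] by (auto simp: one_eSuc zero_enat_def[symmetric] order_less_le_trans)

lemma arrive_in_states:
  assumes "S \<in> pull_states P" "i \<in> open_servers S"
  shows "arrive i S \<in> pull_states P"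
proof -
  obtain Q D where S: "S = (Q, D)" by (cases S)
  have "enat (Suc (Q i)) \<le> buffer P (fst i)"
    using assms(2) S by (simp add: Suc_ile_eq)
  then show ?thesis
    using assms unfolding S pull_states_def arrive_def by auto
qed

lemma depart_in_states:
  assumes "S \<in> pull_states P" "i \<in> busy S" "r \<in> {1..R}"
  shows "depart i r S \<in> pull_states P"
proof -
  obtain Q D where S: "S = (Q, D)" by (cases S)
  have "enat (Q i) \<le> buffer P (fst i)" using pull_statesD(3)[OF assms(1)] assms(2) S by auto
  then have "enat (Q i - 1) \<le> buffer P (fst i)" by (meson diff_le_self enat_ord_simps(1) order_trans)
  then show ?thesis
    using assms unfolding S pull_states_def depart_def by auto
qed

lemma succ_in_states:
  "S \<in> pull_states P \<Longrightarrow> 0 < pull2_rate P S S' \<Longrightarrow> S' \<in> pull_states P"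
  by (erule pull2_rate_cases) (auto simp: arrive_in_states depart_in_states)

text \<open>Empty routers spread their customers evenly over all servers, which gives the uniform
  part. An idle server also gets an equal share of the stream of the router holding its message. A
  busy server has location 0, which is no router.\<close>

lemma join_rate_eq:
  assumes S: "S \<in> pull_states P" and i: "i \<in> I"
  shows "join_rate S i = empty_frac S * lam +
    (if fst S i = 0 then arrival_rate P / (real R * msgs S (snd S i)) else 0)"
proof -
  define A where "A r = {i \<in> I. snd S i = r}" for r
  have rp: "routing_prob P S r i = of_bool (A r = {}) * (1 / real n) +
      (if snd S i = r \<and> A r \<noteq> {} then 1 / real (card (A r)) else 0)" for r
    using i by (auto simp: routing_prob_def A_def Let_def split: prod.splits)
  have "(\<Sum>r = 1..R. routing_prob P S r i) =
      (\<Sum>r = 1..R. of_bool (A r = {}) * (1 / real n)) +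
      (\<Sum>r = 1..R. if snd S i = r \<and> A r \<noteq> {} then 1 / real (card (A r)) else 0)"
    unfolding rp by (rule sum.distrib)
  also have "(\<Sum>r = 1..R. of_bool (A r = {}) * (1 / real n)) = real (card {r \<in> {1..R}. A r = {}}) / real n"
    by (simp add: sum_distrib_right[symmetric] sum_divide_distrib[symmetric] Int_def conj_commute)
  also have "(\<Sum>r = 1..R. if snd S i = r \<and> A r \<noteq> {} then 1 / real (card (A r)) else 0) =
      (if fst S i = 0 then 1 / msgs S (snd S i) else 0)"
  proof (cases "fst S i = 0")
    case True
    then have "(\<Sum>r = 1..R. if snd S i = r \<and> A r \<noteq> {} then 1 / real (card (A r)) else 0) =
        (\<Sum>r = 1..R. if snd S i = r then 1 / real (card (A (snd S i))) else 0)"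
      using i by (intro sum.cong) (auto simp: A_def)
    then show ?thesis
      using True pull_statesD(1)[OF S i True] by (simp add: msgs_def A_def)
  next
    case False
    then have "snd S i = 0" using pull_statesD(2)[OF S i] by simp
    then show ?thesis using False by (auto intro!: sum.neutral)
  qed
  finally show ?thesis
    unfolding join_rate_def empty_frac_def arrival A_def using n_pos R_pos
    by (auto simp: field_simps)
qed

section \<open>Idle servers and pull-messages\<close>

definition idle_count :: "pull_state \<Rightarrow> real" where
  "idle_count S = real (card (idle S))"

definition idling_rate :: "pull_state \<Rightarrow> real" where
  "idling_rate S = (\<Sum>i | i \<in> I \<and> fst S i = 1. mu i)"

text \<open>Rate of arrivals at idle servers: chance hits by customers of empty routers, and all
  customers of the other routers.\<close>

definition idle_arrival_rate :: "pull_state \<Rightarrow> real" where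
  "idle_arrival_rate S =
     empty_frac S * lam * idle_count S + (1 - empty_frac S) * arrival_rate P"

text \<open>With truncated subtraction this is \<open>U\<close>. Arrivals at idle servers, whose
  rate is not controlled by \<open>empty_frac\<close>, leave it unchanged.\<close>

definition excess :: "pull_state \<Rightarrow> real" where
  "excess S = (\<Sum>i\<in>I. real (fst S i - 1))"

definition excess_square :: "pull_state \<Rightarrow> real" where
  "excess_square S = (\<Sum>i\<in>I. (real (fst S i - 1))\<^sup>2 / 2)"

lemma empty_frac_bounds: "0 \<le> empty_frac S" "empty_frac S \<le> 1"
proof -
  have "card {r \<in> {1..R}. {i \<in> I. snd S i = r} = {}} \<le> card {1..R}"
    by (rule card_mono) auto
  then show "0 \<le> empty_frac S" "empty_frac S \<le> 1"
    using R_pos by (auto simp: empty_frac_def)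
qed

lemma sum_msgs:
  fixes g :: "nat \<Rightarrow> real"
  assumes "S \<in> pull_states P"
  shows "(\<Sum>i\<in>idle S. g (snd S i)) = (\<Sum>r = 1..R. msgs S r * g r)"
proof -
  have "(\<Sum>i\<in>idle S. g (snd S i)) = (\<Sum>r = 1..R. \<Sum>i | i \<in> idle S \<and> snd S i = r. g (snd S i))"
    by (rule sum.group[symmetric]) (use pull_statesD(1)[OF assms] in auto)
  also have "\<dots> = (\<Sum>r = 1..R. msgs S r * g r)"
  proof (rule sum.cong[OF refl])
    fix r assume "r \<in> {1..R}"
    then have "{i. i \<in> idle S \<and> snd S i = r} = {i \<in> I. snd S i = r}"
      using pull_statesD(2)[OF assms] by force
    then show "(\<Sum>i | i \<in> idle S \<and> snd S i = r. g (snd S i)) = msgs S r * g r"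
      by (simp add: msgs_def)
  qed
  finally show ?thesis .
qed

lemma sum_msgs_eq_idle_count: "S \<in> pull_states P \<Longrightarrow> (\<Sum>r = 1..R. msgs S r) = idle_count S"
  using sum_msgs[of S "\<lambda>_. 1"] by (simp add: idle_count_def)

lemma msgs_eq_sum: "msgs S r = (\<Sum>i\<in>I. of_bool (snd S i = r))"
  by (simp add: msgs_def Int_def conj_commute)

lemma idle_count_eq_sum: "idle_count S = (\<Sum>i\<in>I. of_bool (fst S i = 0))"
  by (simp add: idle_count_def Int_def conj_commute)

lemma idle_count_le: "idle_count S \<le> real n"
  unfolding idle_count_def by (simp add: card_mono)

lemma idle_arrival_rate_le: "idle_arrival_rate S \<le> arrival_rate P"
proof -
  have "empty_frac S * lam * idle_count S \<le> empty_frac S * lam * real n"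
    using empty_frac_bounds lam_pos idle_count_le by (intro mult_left_mono) auto
  then show ?thesis by (simp add: idle_arrival_rate_def arrival algebra_simps)
qed

lemma idling_rate_bounds: "0 \<le> idling_rate S" "idling_rate S \<le> mumax * real n"
proof -
  show "0 \<le> idling_rate S"
    unfolding idling_rate_def by (intro sum_nonneg) (auto simp: service_rate_nonneg)
  have "idling_rate S \<le> (\<Sum>i | i \<in> I \<and> fst S i = 1. mumax)"
    unfolding idling_rate_def by (intro sum_mono le_mumax) auto
  also have "\<dots> \<le> (\<Sum>i\<in>I. mumax)" using mumax_pos by (intro sum_mono2) auto
  finally show "idling_rate S \<le> mumax * real n" by (simp add: mult.commute)
qed

lemma fst_arrive: "fst (arrive i S) = (fst S)(i := fst S i + 1)"
  and snd_arrive: "snd (arrive i S) = (snd S)(i := 0)"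
  and fst_depart: "fst (depart i r S) = (fst S)(i := fst S i - 1)"
  and snd_depart: "snd (depart i r S) = (snd S)(i := (if fst S i = 1 then r else 0))"
  by (simp_all add: arrive_def depart_def split: prod.splits)

lemma sum_fst_arrive:
  fixes \<phi> :: "nat \<Rightarrow> real"
  shows "i \<in> I \<Longrightarrow> (\<Sum>j\<in>I. \<phi> (fst (arrive i S) j)) = (\<Sum>j\<in>I. \<phi> (fst S j)) + (\<phi> (fst S i + 1) - \<phi> (fst S i))"
  unfolding fst_arrive by (rule sum_fun_upd) auto

lemma sum_fst_depart:
  fixes \<phi> :: "nat \<Rightarrow> real"
  shows "i \<in> I \<Longrightarrow> (\<Sum>j\<in>I. \<phi> (fst (depart i r S) j)) = (\<Sum>j\<in>I. \<phi> (fst S j)) + (\<phi> (fst S i - 1) - \<phi> (fst S i))"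
  unfolding fst_depart by (rule sum_fun_upd) auto

lemma msgs_arrive: "i \<in> I \<Longrightarrow> r \<noteq> 0 \<Longrightarrow> msgs (arrive i S) r = msgs S r - of_bool (snd S i = r)"
  unfolding msgs_eq_sum snd_arrive by (subst sum_fun_upd) auto

lemma msgs_depart:
  assumes "S \<in> pull_states P" "i \<in> busy S" "r \<noteq> 0"
  shows "msgs (depart i r' S) r = msgs S r + of_bool (fst S i = 1 \<and> r = r')"
proof -
  have "snd S i = 0" using pull_statesD(2)[OF assms(1)] assms(2) by simp
  then show ?thesis
    unfolding msgs_eq_sum snd_depart using assms(2,3) by (subst sum_fun_upd) auto
qed

lemma idle_count_arrive: "i \<in> I \<Longrightarrow> idle_count (arrive i S) = idle_count S - of_bool (fst S i = 0)"
  unfolding idle_count_eq_sum by (subst sum_fst_arrive) auto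

lemma idle_count_depart: "i \<in> busy S \<Longrightarrow> idle_count (depart i r S) = idle_count S + of_bool (fst S i = 1)"
  unfolding idle_count_eq_sum by (subst sum_fst_depart) auto

text \<open>For functions of the message counts. Router \<open>r\<close> loses messages through
  chance hits at a rate proportional to their number and, if it has any, through its own stream; new
  messages are spread evenly over the routers at total rate \<open>idling_rate\<close>.\<close>

lemma drift_messages:
  assumes S: "S \<in> pull_states P"
    and a_idle: "\<And>i. i \<in> idle S \<Longrightarrow> g (arrive i S) - g S = a (snd S i)"
    and a_busy: "\<And>i. i \<in> busy S \<Longrightarrow> g (arrive i S) = g S"
    and d_one: "\<And>i r. i \<in> I \<Longrightarrow> fst S i = 1 \<Longrightarrow> r \<in> {1..R} \<Longrightarrow> g (depart i r S) - g S = b r"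
    and d_more: "\<And>i r. i \<in> I \<Longrightarrow> fst S i > 1 \<Longrightarrow> r \<in> {1..R} \<Longrightarrow> g (depart i r S) = g S"
  shows "drift (pull2_rate P) g S =
    (\<Sum>r = 1..R. (empty_frac S * lam * msgs S r + arrival_rate P / real R * of_bool (msgs S r > 0)) * a r) +
    idling_rate S / real R * (\<Sum>r = 1..R. b r)"
proof -
  define c where "c r = empty_frac S * lam + arrival_rate P / (real R * msgs S r)" for r
  have "(\<Sum>i\<in>open_servers S. join_rate S i * (g (arrive i S) - g S)) =
      (\<Sum>i\<in>idle S. join_rate S i * (g (arrive i S) - g S))"
    using idle_open a_busy by (intro sum.mono_neutral_right) auto
  also have "\<dots> = (\<Sum>i\<in>idle S. c (snd S i) * a (snd S i))"
    using a_idle by (intro sum.cong) (auto simp: join_rate_eq[OF S] c_def)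
  also have "\<dots> = (\<Sum>r = 1..R. msgs S r * (c r * a r))"
    by (rule sum_msgs[OF S])
  also have "\<dots> = (\<Sum>r = 1..R. (empty_frac S * lam * msgs S r +
      arrival_rate P / real R * of_bool (msgs S r > 0)) * a r)"
  proof (intro sum.cong refl)
    fix r
    have "0 \<le> msgs S r" by (simp add: msgs_def)
    then have "msgs S r * c r = empty_frac S * lam * msgs S r + arrival_rate P / real R * of_bool (msgs S r > 0)"
      by (cases "msgs S r = 0") (auto simp: c_def algebra_simps)
    then show "msgs S r * (c r * a r) = (empty_frac S * lam * msgs S r +
      arrival_rate P / real R * of_bool (msgs S r > 0)) * a r"
      by (simp add: mult.assoc[symmetric])
  qed
  finally have 1: "(\<Sum>i\<in>open_servers S. join_rate S i * (g (arrive i S) - g S)) = \<dots>" .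
  have "(\<Sum>i\<in>busy S. \<Sum>r = 1..R. mu i / real R * (g (depart i r S) - g S)) =
      (\<Sum>i | i \<in> I \<and> fst S i = 1. \<Sum>r = 1..R. mu i / real R * (g (depart i r S) - g S))"
  proof (rule sum.mono_neutral_right)
    show "\<forall>i\<in>busy S - {i. i \<in> I \<and> fst S i = 1}. (\<Sum>r = 1..R. mu i / real R * (g (depart i r S) - g S)) = 0"
    proof (intro ballI sum.neutral)
      fix i r assume "i \<in> busy S - {i. i \<in> I \<and> fst S i = 1}" "r \<in> {1..R}"
      then show "mu i / real R * (g (depart i r S) - g S) = 0"
        using d_more[of i r] by auto
    qed
  qed auto
  also have "\<dots> = (\<Sum>i | i \<in> I \<and> fst S i = 1. \<Sum>r = 1..R. mu i / real R * b r)"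
    by (intro sum.cong refl) (simp add: d_one)
  also have "\<dots> = idling_rate S / real R * (\<Sum>r = 1..R. b r)"
    by (subst sum.swap) (simp add: idling_rate_def sum_distrib_left sum_distrib_right sum_divide_distrib)
  finally show ?thesis unfolding drift_pull2 1 by simp
qed

lemma sum_idle_arrival_rates:
  assumes "S \<in> pull_states P"
  shows "(\<Sum>r = 1..R. empty_frac S * lam * msgs S r + arrival_rate P / real R * of_bool (msgs S r > 0)) =
    idle_arrival_rate S"
proof -
  have "{r \<in> {1..R}. {i \<in> I. snd S i = r} = {}} = {1..R} - {r \<in> {1..R}. msgs S r > 0}"
    by (auto simp: msgs_def card_gt_0_iff)
  then have "card {r \<in> {1..R}. {i \<in> I. snd S i = r} = {}} = R - card {r \<in> {1..R}. msgs S r > 0}"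
    by (simp only:) (subst card_Diff_subset, auto)
  moreover have "card {r \<in> {1..R}. msgs S r > 0} \<le> card {1..R}" by (rule card_mono) auto
  ultimately have "real (card {r \<in> {1..R}. msgs S r > 0}) = real R * (1 - empty_frac S)"
    using R_pos by (simp add: empty_frac_def of_nat_diff field_simps)
  moreover have "(\<Sum>r = 1..R. of_bool (msgs S r > 0) :: real) = real (card {r \<in> {1..R}. msgs S r > 0})"
    by (simp add: Int_def conj_commute)
  ultimately have "(\<Sum>r = 1..R. arrival_rate P / real R * of_bool (msgs S r > 0)) =
      arrival_rate P * (1 - empty_frac S)"
    unfolding sum_distrib_left[symmetric] using R_pos by simp
  then show ?thesis
    by (simp add: sum.distrib sum_distrib_left[symmetric] sum_msgs_eq_idle_count[OF assms, simplified]
        idle_arrival_rate_def)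
qed

lemma drift_idle_count:
  assumes S: "S \<in> pull_states P"
    and up: "\<And>i r. i \<in> I \<Longrightarrow> fst S i = 1 \<Longrightarrow> r \<in> {1..R} \<Longrightarrow> g (depart i r S) - g S = u"
    and down: "\<And>i. i \<in> idle S \<Longrightarrow> g (arrive i S) - g S = d"
    and "\<And>i. i \<in> busy S \<Longrightarrow> g (arrive i S) = g S"
    and "\<And>i r. i \<in> I \<Longrightarrow> fst S i > 1 \<Longrightarrow> r \<in> {1..R} \<Longrightarrow> g (depart i r S) = g S"
  shows "drift (pull2_rate P) g S = idle_arrival_rate S * d + idling_rate S * u"
  using drift_messages[OF S, where g = g and a = "\<lambda>_. d" and b = "\<lambda>_. u"] assms(2-) R_pos
  by (simp add: sum_idle_arrival_rates[OF S, symmetric] sum_distrib_right[symmetric])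

lemma drift_idle_count_square:
  assumes S: "S \<in> pull_states P"
  shows "drift (pull2_rate P) (\<lambda>S. (idle_count S)\<^sup>2) S =
    idle_arrival_rate S * (1 - 2 * idle_count S) + idling_rate S * (2 * idle_count S + 1)"
  by (rule drift_idle_count[OF S])
    (auto simp: idle_count_arrive idle_count_depart power2_eq_square algebra_simps)

lemma drift_sum_msgs_square:
  assumes S: "S \<in> pull_states P"
  shows "drift (pull2_rate P) (\<lambda>S. \<Sum>r = 1..R. (msgs S r)\<^sup>2) S =
    idle_arrival_rate S - 2 * empty_frac S * lam * (\<Sum>r = 1..R. (msgs S r)\<^sup>2)
      - 2 * arrival_rate P / real R * idle_count S
      + idling_rate S / real R * (2 * idle_count S + real R)"
proof -
  have upd: "(\<Sum>r = 1..R. (msgs S r + x * of_bool (r = r'))\<^sup>2) - (\<Sum>r = 1..R. (msgs S r)\<^sup>2) =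
      2 * x * msgs S r' + x\<^sup>2" if "r' \<in> {1..R}" for r' x
  proof -
    have "(\<Sum>r = 1..R. (msgs S r + x * of_bool (r = r'))\<^sup>2) - (\<Sum>r = 1..R. (msgs S r)\<^sup>2) =
        (\<Sum>r = 1..R. if r = r' then 2 * x * msgs S r' + x\<^sup>2 else 0)"
      unfolding sum_subtractf[symmetric]
      by (intro sum.cong refl) (auto simp: power2_eq_square algebra_simps)
    then show ?thesis using that by simp
  qed
  have "drift (pull2_rate P) (\<lambda>S. \<Sum>r = 1..R. (msgs S r)\<^sup>2) S =
    (\<Sum>r = 1..R. (empty_frac S * lam * msgs S r + arrival_rate P / real R * of_bool (msgs S r > 0))
       * (1 - 2 * msgs S r)) +
    idling_rate S / real R * (\<Sum>r = 1..R. 2 * msgs S r + 1)"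
  proof (rule drift_messages[OF S])
    fix i assume i: "i \<in> idle S"
    have "(\<Sum>r = 1..R. (msgs (arrive i S) r)\<^sup>2) = (\<Sum>r = 1..R. (msgs S r + (- 1) * of_bool (r = snd S i))\<^sup>2)"
      using i by (intro sum.cong refl) (auto simp: msgs_arrive)
    then show "(\<Sum>r = 1..R. (msgs (arrive i S) r)\<^sup>2) - (\<Sum>r = 1..R. (msgs S r)\<^sup>2) = 1 - 2 * msgs S (snd S i)"
      using upd[of "snd S i" "-1"] pull_statesD(1)[OF S, of i] i by simp
  next
    fix i assume "i \<in> busy S"
    then show "(\<Sum>r = 1..R. (msgs (arrive i S) r)\<^sup>2) = (\<Sum>r = 1..R. (msgs S r)\<^sup>2)"
      using pull_statesD(2)[OF S, of i] by (intro sum.cong refl) (auto simp: msgs_arrive)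
  next
    fix i r' assume i: "i \<in> I" "fst S i = 1" "r' \<in> {1..R}"
    then have "(\<Sum>r = 1..R. (msgs (depart i r' S) r)\<^sup>2) = (\<Sum>r = 1..R. (msgs S r + 1 * of_bool (r = r'))\<^sup>2)"
      by (intro sum.cong refl) (auto simp: msgs_depart[OF S])
    then show "(\<Sum>r = 1..R. (msgs (depart i r' S) r)\<^sup>2) - (\<Sum>r = 1..R. (msgs S r)\<^sup>2) = 2 * msgs S r' + 1"
      using upd[of r' 1] i by simp
  next
    fix i r' assume "i \<in> I" "1 < fst S i" "r' \<in> {1..R}"
    then show "(\<Sum>r = 1..R. (msgs (depart i r' S) r)\<^sup>2) = (\<Sum>r = 1..R. (msgs S r)\<^sup>2)"
      by (intro sum.cong refl) (auto simp: msgs_depart[OF S])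
  qed
  \<comment> \<open>Because \<open>of_bool (m > 0) * m = m\<close>, the linear term is the same for
    empty and nonempty routers and sums to a multiple of \<open>idle_count\<close>.\<close>
  also have "(\<Sum>r = 1..R. (empty_frac S * lam * msgs S r + arrival_rate P / real R * of_bool (msgs S r > 0))
       * (1 - 2 * msgs S r)) =
      (\<Sum>r = 1..R. (empty_frac S * lam * msgs S r + arrival_rate P / real R * of_bool (msgs S r > 0))
        - 2 * empty_frac S * lam * (msgs S r)\<^sup>2 - 2 * arrival_rate P / real R * msgs S r)"
  proof (intro sum.cong refl)
    fix r
    have "0 \<le> msgs S r" by (simp add: msgs_def)
    then show "(empty_frac S * lam * msgs S r + arrival_rate P / real R * of_bool (msgs S r > 0))
       * (1 - 2 * msgs S r) = (empty_frac S * lam * msgs S r + arrival_rate P / real R * of_bool (msgs S r > 0))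
        - 2 * empty_frac S * lam * (msgs S r)\<^sup>2 - 2 * arrival_rate P / real R * msgs S r"
      using R_pos by (cases "msgs S r = 0") (auto simp: field_simps power2_eq_square)
  qed
  also have "\<dots> = idle_arrival_rate S - 2 * empty_frac S * lam * (\<Sum>r = 1..R. (msgs S r)\<^sup>2)
      - 2 * arrival_rate P / real R * idle_count S"
    unfolding sum_subtractf sum_idle_arrival_rates[OF S]
    by (simp only: sum_distrib_left[symmetric] sum_msgs_eq_idle_count[OF S])
  also have "(\<Sum>r = 1..R. 2 * msgs S r + 1) = 2 * idle_count S + real R"
    by (simp add: sum.distrib sum_distrib_left[symmetric] sum_msgs_eq_idle_count[OF S, simplified])
  finally show ?thesis .
qed

text \<open>While some routers are empty, the difference between their numbers of messages and those
  of the others shrinks; this is what bounds the product of \<open>empty_frac\<close> and \<open>idle_count\<close>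
  on average.\<close>

definition imbalance :: "pull_state \<Rightarrow> real" where
  "imbalance S = (\<Sum>r = 1..R. (msgs S r)\<^sup>2) - (idle_count S)\<^sup>2 / real R"

text \<open>\<open>imbalance\<close> is the sum of squared deviations of the message counts from
  their mean. New messages are placed uniformly, so their contributions of order
  \<open>idle_count * n\<close> to the two squares cancel. Consumption does not cancel: the share of
  the stream that meets empty routers leaves the negative term.\<close>

lemma drift_imbalance:
  assumes S: "S \<in> pull_states P"
  shows "drift (pull2_rate P) imbalance S \<le>
    - 2 * empty_frac S * arrival_rate P * idle_count S / real R + (lam + mumax) * real n"
proof -
  define \<alpha> M d \<iota> sq where "\<alpha> = empty_frac S" and "M = idle_count S" and "d = idle_arrival_rate S"
    and "\<iota> = idling_rate S" and "sq = (\<Sum>r = 1..R. (msgs S r)\<^sup>2)"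
  have "drift (pull2_rate P) imbalance S =
      drift (pull2_rate P) (\<lambda>S. \<Sum>r = 1..R. (msgs S r)\<^sup>2) S -
      1 / real R * drift (pull2_rate P) (\<lambda>S. (idle_count S)\<^sup>2) S"
    unfolding drift_cmult[symmetric] drift_diff[symmetric] imbalance_def[abs_def] by simp
  also have "\<dots> = d - 2 * \<alpha> * lam * sq - 2 * arrival_rate P / real R * M + \<iota> / real R * (2 * M + real R)
      - 1 / real R * (d * (1 - 2 * M) + \<iota> * (2 * M + 1))"
    unfolding drift_sum_msgs_square[OF S] drift_idle_count_square[OF S] \<alpha>_def M_def d_def \<iota>_def sq_def
    by simp
  also have "\<dots> = (d + \<iota>) * (1 - 1 / real R) - 2 * \<alpha> * lam * sq - 2 * arrival_rate P / real R * M + 2 * M * d / real R"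
    using R_pos by (simp add: field_simps)
  also have "\<dots> = (d + \<iota>) * (1 - 1 / real R) - 2 * \<alpha> * lam * (sq - M\<^sup>2 / real R)
      - 2 * \<alpha> * arrival_rate P * M / real R"
  proof -
    have d: "d = \<alpha> * lam * M + (1 - \<alpha>) * arrival_rate P"
      by (simp add: d_def idle_arrival_rate_def \<alpha>_def M_def)
    have "2 * M * d / real R = 2 * \<alpha> * lam * (M\<^sup>2 / real R) + 2 * arrival_rate P / real R * M
        - 2 * \<alpha> * arrival_rate P * M / real R"
      unfolding d using R_pos by (simp add: field_simps power2_eq_square)
    then show ?thesis by (simp add: algebra_simps)
  qed
  also have "\<dots> \<le> (lam + mumax) * real n - 0 - 2 * \<alpha> * arrival_rate P * M / real R"
  proof (intro diff_mono order_refl)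
    have "M\<^sup>2 \<le> real R * sq"
      using sum_squared_le_sum_of_squares[of "msgs S" "{1..R}"]
      unfolding M_def sq_def sum_msgs_eq_idle_count[OF S, symmetric] by (simp add: mult.commute)
    then have "0 \<le> sq - M\<^sup>2 / real R" using R_pos by (simp add: field_simps)
    then show "0 \<le> 2 * \<alpha> * lam * (sq - M\<^sup>2 / real R)"
      using empty_frac_bounds[of S] lam_pos by (simp add: \<alpha>_def)
    have d: "0 \<le> d" "d \<le> lam * real n"
      using idle_arrival_rate_le[of S] empty_frac_bounds[of S] lam_pos arrival_pos
      by (auto simp: d_def arrival idle_arrival_rate_def idle_count_def)
    have \<iota>: "0 \<le> \<iota>" "\<iota> \<le> mumax * real n" using idling_rate_bounds[of S] by (auto simp: \<iota>_def)
    have "(d + \<iota>) * (1 - 1 / real R) \<le> (d + \<iota>) * 1"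
      using d \<iota> R_pos by (intro mult_left_mono) auto
    also have "\<dots> \<le> (lam + mumax) * real n" using d \<iota> by (simp add: algebra_simps)
    finally show "(d + \<iota>) * (1 - 1 / real R) \<le> (lam + mumax) * real n" .
  qed
  finally show ?thesis by (simp add: \<alpha>_def M_def)
qed

section \<open>Queue lengths\<close>

lemma drift_sum_queues:
  fixes \<phi> :: "nat \<Rightarrow> real"
  shows "drift (pull2_rate P) (\<lambda>S. \<Sum>i\<in>I. \<phi> (fst S i)) S =
    (\<Sum>i\<in>open_servers S. join_rate S i * (\<phi> (fst S i + 1) - \<phi> (fst S i))) +
    (\<Sum>i\<in>busy S. mu i * (\<phi> (fst S i - 1) - \<phi> (fst S i)))"
  unfolding drift_pull2 using R_pos by (simp add: sum_fst_arrive sum_fst_depart)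

lemma join_rate_busy:
  "S \<in> pull_states P \<Longrightarrow> i \<in> busy S \<Longrightarrow> join_rate S i = empty_frac S * lam"
  by (simp add: join_rate_eq)

lemma sum_open_servers_le:
  assumes S: "S \<in> pull_states P"
    and g: "\<And>i. i \<in> busy S \<Longrightarrow> 0 \<le> g i" "\<And>i. i \<in> idle S \<Longrightarrow> g i = 0"
  shows "(\<Sum>i\<in>open_servers S. join_rate S i * g i) \<le> empty_frac S * lam * (\<Sum>i\<in>busy S. g i)"
proof -
  have "(\<Sum>i\<in>open_servers S. join_rate S i * g i) = (\<Sum>i\<in>open_servers S \<inter> busy S. join_rate S i * g i)"
    using g(2) by (intro sum.mono_neutral_right) auto
  also have "\<dots> \<le> (\<Sum>i\<in>busy S. join_rate S i * g i)"
    using g(1) by (intro sum_mono2 mult_nonneg_nonneg join_rate_nonneg) auto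
  also have "\<dots> = (\<Sum>i\<in>busy S. empty_frac S * lam * g i)"
    by (intro sum.cong refl) (simp only: join_rate_busy[OF S])
  finally show ?thesis by (simp add: sum_distrib_left)
qed

lemma drift_excess:
  assumes S: "S \<in> pull_states P"
  shows "drift (pull2_rate P) excess S \<le>
    empty_frac S * lam * (real n - idle_count S) - (\<Sum>i | i \<in> I \<and> 2 \<le> fst S i. mu i)"
proof -
  have "(\<Sum>i\<in>open_servers S. join_rate S i * (real (fst S i + 1 - 1) - real (fst S i - 1))) \<le>
      empty_frac S * lam * (\<Sum>i\<in>busy S. real (fst S i + 1 - 1) - real (fst S i - 1))"
    by (rule sum_open_servers_le[OF S]) (auto simp: of_nat_diff)
  also have "(\<Sum>i\<in>busy S. real (fst S i + 1 - 1) - real (fst S i - 1)) = (\<Sum>i\<in>busy S. 1)"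
    by (intro sum.cong refl) (auto simp: of_nat_diff)
  also have "\<dots> = real n - idle_count S"
  proof -
    have "busy S = I - idle S" by auto
    then show ?thesis unfolding idle_count_def by (simp add: card_Diff_subset of_nat_diff card_mono)
  qed
  finally have 1: "(\<Sum>i\<in>open_servers S. join_rate S i * (real (fst S i + 1 - 1) - real (fst S i - 1))) \<le>
    empty_frac S * lam * (real n - idle_count S)" .
  have "(\<Sum>i\<in>busy S. mu i * (real (fst S i - 1 - 1) - real (fst S i - 1))) =
      (\<Sum>i | i \<in> I \<and> 2 \<le> fst S i. mu i * (real (fst S i - 1 - 1) - real (fst S i - 1)))"
    by (intro sum.mono_neutral_right) auto
  also have "\<dots> = (\<Sum>i | i \<in> I \<and> 2 \<le> fst S i. - mu i)"
    by (intro sum.cong refl) (auto simp: of_nat_diff)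
  finally show ?thesis
    using 1 unfolding excess_def[abs_def] drift_sum_queues[where \<phi> = "\<lambda>q. real (q - 1)"]
    by (simp add: sum_negf)
qed

text \<open>The coefficient of \<open>excess\<close> can be positive when \<open>empty_frac\<close>
  is near 1, since \<open>lam\<close> may exceed the smallest service rate. The potential below is
  built to compensate this.\<close>

lemma drift_excess_square:
  assumes S: "S \<in> pull_states P"
  shows "drift (pull2_rate P) excess_square S \<le>
    (empty_frac S * lam - mumin) * excess S + (lam + mumax) * real n"
proof -
  define \<phi> where "\<phi> q = (real (q - 1))\<^sup>2 / 2" for q
  have up: "\<phi> (q + 1) - \<phi> q = real (q - 1) + 1 / 2" if "0 < q" for q
    using that by (cases q) (auto simp: \<phi>_def power2_eq_square algebra_simps)
  have down: "\<phi> (q - 1) - \<phi> q \<le> 1 / 2 - real (q - 1)" for q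
  proof (cases "q \<le> 1")
    case True then show ?thesis by (auto simp: \<phi>_def)
  next
    case False
    then obtain p where "q = Suc (Suc p)" by (metis One_nat_def Suc_leI le_Suc_eq not_less_eq_eq not0_implies_Suc)
    then show ?thesis by (simp add: \<phi>_def power2_eq_square algebra_simps)
  qed
  have ex: "(\<Sum>i\<in>busy S. real (fst S i - 1)) = excess S"
    unfolding excess_def by (intro sum.mono_neutral_left) auto
  have "(\<Sum>i\<in>open_servers S. join_rate S i * (\<phi> (fst S i + 1) - \<phi> (fst S i))) \<le>
      empty_frac S * lam * (\<Sum>i\<in>busy S. \<phi> (fst S i + 1) - \<phi> (fst S i))"
  proof (rule sum_open_servers_le[OF S])
    show "0 \<le> \<phi> (fst S i + 1) - \<phi> (fst S i)" if "i \<in> busy S" for i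
      using up[of "fst S i"] that by simp
    show "\<phi> (fst S i + 1) - \<phi> (fst S i) = 0" if "i \<in> idle S" for i
      using that by (simp add: \<phi>_def)
  qed
  also have "(\<Sum>i\<in>busy S. \<phi> (fst S i + 1) - \<phi> (fst S i)) = (\<Sum>i\<in>busy S. real (fst S i - 1) + 1 / 2)"
    by (intro sum.cong refl up) auto
  also have "\<dots> = excess S + real (card (busy S)) / 2"
    by (simp only: sum.distrib ex) simp
  also have "empty_frac S * lam * \<dots> \<le> empty_frac S * lam * excess S + lam * real n"
  proof -
    have "real (card (busy S)) / 2 \<le> real n" using card_mono[of I "busy S"] by force
    then have "empty_frac S * (lam * (real (card (busy S)) / 2)) \<le> 1 * (lam * real n)"
      using empty_frac_bounds[of S] lam_pos by (intro mult_mono mult_left_mono) auto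
    then show ?thesis by (simp add: algebra_simps)
  qed
  finally have 1: "(\<Sum>i\<in>open_servers S. join_rate S i * (\<phi> (fst S i + 1) - \<phi> (fst S i))) \<le>
      empty_frac S * lam * excess S + lam * real n" .
  have "(\<Sum>i\<in>busy S. mu i * (\<phi> (fst S i - 1) - \<phi> (fst S i))) \<le>
      (\<Sum>i\<in>busy S. mumax - mumin * real (fst S i - 1))"
  proof (rule sum_mono)
    fix i assume i: "i \<in> busy S"
    have "mu i * (\<phi> (fst S i - 1) - \<phi> (fst S i)) \<le> mu i * (1 / 2 - real (fst S i - 1))"
      using i down[of "fst S i"] less_imp_le[OF mu_pos, of i] by (intro mult_left_mono) auto
    moreover have "mumin * real (fst S i - 1) \<le> mu i * real (fst S i - 1)"
      using i mumin_le by (intro mult_right_mono) auto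
    moreover have "mu i * (1 / 2) \<le> mumax" using i le_mumax[of i] mumax_pos by auto
    ultimately show "mu i * (\<phi> (fst S i - 1) - \<phi> (fst S i)) \<le> mumax - mumin * real (fst S i - 1)"
      by (simp add: algebra_simps)
  qed
  also have "\<dots> = real (card (busy S)) * mumax - mumin * excess S"
    using ex by (simp add: sum_subtractf sum_distrib_left[symmetric])
  also have "real (card (busy S)) * mumax \<le> real n * mumax"
    using mumax_pos by (intro mult_right_mono) (auto intro: card_mono)
  finally show ?thesis
    using 1 unfolding excess_square_def[abs_def] \<phi>_def[symmetric] drift_sum_queues
    by (simp add: algebra_simps)
qed

section \<open>The potential that controls the fraction of empty routers\<close>

definition cutoff :: real where
  "cutoff = \<delta> / (2 * mumax) * real n"

text \<open>A linear ramp instead of an indicator: its slope is of order 1/n, so a unit change of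
  the argument, at rates of order n, costs only a constant.\<close>

definition idle_weight :: "nat \<Rightarrow> real" where
  "idle_weight l = max 0 (1 - real l / cutoff)"

text \<open>The discrete antiderivative of \<open>idle_weight\<close>, which makes its drift the
  weight times the net growth rate of the number of idle servers.\<close>

definition idle_potential :: "pull_state \<Rightarrow> real" where
  "idle_potential S = (\<Sum>l<card (idle S). idle_weight l)"

lemma cutoff_pos: "0 < cutoff"
  unfolding cutoff_def using \<delta>_pos mumax_pos n_pos by simp

lemma idle_weight_bounds: "0 \<le> idle_weight l" "idle_weight l \<le> 1"
  using cutoff_pos by (auto simp: idle_weight_def)

lemma idle_weight_pred_le: "idle_weight (l - 1) \<le> idle_weight l + 1 / cutoff"
proof -
  have "real l / cutoff - 1 / cutoff \<le> real (l - 1) / cutoff"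
    using cutoff_pos by (cases l) (auto simp: add_divide_distrib)
  then show ?thesis using cutoff_pos by (simp add: idle_weight_def)
qed

lemma one_minus_idle_weight_le: "1 - idle_weight l \<le> real l / cutoff"
  by (simp add: idle_weight_def)

lemma idle_weight_mult_le: "idle_weight l * (mumax * real l) \<le> idle_weight l * (\<delta> / 2 * real n)"
proof (cases "real l < cutoff")
  case True
  then have "mumax * real l \<le> \<delta> / 2 * real n"
    using mumax_pos by (simp add: cutoff_def field_simps)
  then show ?thesis using idle_weight_bounds by (intro mult_left_mono) auto
next
  case False
  then have "idle_weight l = 0" using cutoff_pos by (simp add: idle_weight_def)
  then show ?thesis by simp
qed

lemma idle_potential_bounds: "0 \<le> idle_potential S" "idle_potential S \<le> real n"
proof -
  show "0 \<le> idle_potential S" unfolding idle_potential_def by (intro sum_nonneg idle_weight_bounds)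
  have "idle_potential S \<le> (\<Sum>l<card (idle S). 1)" unfolding idle_potential_def by (intro sum_mono idle_weight_bounds)
  also have "\<dots> \<le> real n" by (simp add: card_mono)
  finally show "idle_potential S \<le> real n" .
qed

text \<open>A server that becomes idle adds the summand at the current count, but one that becomes
  busy removes the summand one place below. This mismatch costs at most \<open>1 / cutoff\<close>
  per arrival.\<close>

lemma drift_idle_potential:
  assumes S: "S \<in> pull_states P"
  shows "idle_weight (card (idle S)) * (idling_rate S - idle_arrival_rate S) - arrival_rate P / cutoff
    \<le> drift (pull2_rate P) idle_potential S"
proof -
  have dep: "card (idle (depart i r S)) = Suc (card (idle S))" if "i \<in> I" "fst S i = 1" for i r
    using idle_count_depart[of i S r] that unfolding idle_count_def by simp
  have dep_more: "card (idle (depart i r S)) = card (idle S)" if "i \<in> I" "fst S i > 1" for i r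
    using idle_count_depart[of i S r] that unfolding idle_count_def by simp
  have arrb: "card (idle (arrive i S)) = card (idle S)" if "i \<in> busy S" for i
    using idle_count_arrive[of i S] that unfolding idle_count_def by simp
  have arri: "card (idle S) = Suc (card (idle (arrive i S)))" if "i \<in> idle S" for i
    using idle_count_arrive[of i S] that unfolding idle_count_def by simp
  have "drift (pull2_rate P) idle_potential S =
      idle_arrival_rate S * (- idle_weight (card (idle S) - 1)) + idling_rate S * idle_weight (card (idle S))"
  proof (rule drift_idle_count[OF S])
    fix i assume "i \<in> idle S"
    then show "idle_potential (arrive i S) - idle_potential S = - idle_weight (card (idle S) - 1)"
      unfolding idle_potential_def by (simp add: arri)
  qed (auto simp: idle_potential_def dep dep_more arrb simp del: One_nat_def)
  moreover have "idle_arrival_rate S * idle_weight (card (idle S) - 1) \<le>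
      idle_arrival_rate S * idle_weight (card (idle S)) + arrival_rate P / cutoff"
  proof -
    have d: "0 \<le> idle_arrival_rate S"
      using empty_frac_bounds[of S] lam_pos arrival_pos
      by (auto simp: idle_arrival_rate_def idle_count_def)
    have "idle_arrival_rate S * idle_weight (card (idle S) - 1) \<le> idle_arrival_rate S * (idle_weight (card (idle S)) + 1 / cutoff)"
      using d by (intro mult_left_mono idle_weight_pred_le)
    moreover have "idle_arrival_rate S * (1 / cutoff) \<le> arrival_rate P * (1 / cutoff)"
      using cutoff_pos by (intro mult_right_mono idle_arrival_rate_le) auto
    ultimately show ?thesis by (simp add: algebra_simps)
  qed
  ultimately show ?thesis by (simp add: algebra_simps)
qed

text \<open>The factor \<open>2 * mumax / \<delta>\<close> is \<open>n / cutoff\<close>. The summand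
  \<open>lam\<close> is the discretisation error of \<open>idle_potential\<close>, the other one the
  error term of \<open>imbalance\<close>.\<close>

definition potential_drift_bound :: real where
  "potential_drift_bound = 2 * mumax / \<delta> * (lam + real R * (lam + mumax))"

text \<open>In the drift of \<open>excess\<close>, the part weighted by \<open>idle_weight\<close> equals the drift of
  \<open>idle_potential\<close> minus the spare capacity, and the remaining part is absorbed by \<open>imbalance\<close>.
  The resulting bound \<open>potential_drift_bound\<close> does not depend on the number of servers.\<close>

definition potential :: "pull_state \<Rightarrow> real" where
  "potential S = excess S - idle_potential S + real R / cutoff * imbalance S"

lemma drift_potential:
  assumes S: "S \<in> pull_states P"
  shows "drift (pull2_rate P) potential S \<le>
    potential_drift_bound - \<delta> / 2 * real n * idle_weight (card (idle S))
      - empty_frac S * arrival_rate P * idle_count S / cutoff"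
proof -
  define \<alpha> M d \<iota> p where "\<alpha> = empty_frac S" and "M = idle_count S" and "d = idle_arrival_rate S"
    and "\<iota> = idling_rate S" and "p = idle_weight (card (idle S))"
  define b where "b = \<alpha> * lam * (real n - M) - (\<Sum>i | i \<in> I \<and> 2 \<le> fst S i. mu i)"
  have p: "0 \<le> p" "p \<le> 1" "1 - p \<le> M / cutoff" "p * (mumax * M) \<le> p * (\<delta> / 2 * real n)"
    using idle_weight_bounds one_minus_idle_weight_le idle_weight_mult_le by (auto simp: p_def M_def idle_count_def)
  have \<alpha>: "0 \<le> \<alpha>" "\<alpha> \<le> 1" using empty_frac_bounds by (auto simp: \<alpha>_def)
  have M: "0 \<le> M" "M \<le> real n" using idle_count_le by (auto simp: M_def idle_count_def)
  define w where "w = (\<Sum>i\<in>idle S. mu i)"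
  \<comment> \<open>A balance of rates: arrivals at busy servers are all arrivals minus those at
    idle servers, and the service at queues of length at least 2 is the total capacity minus that of
    the shorter queues.\<close>
  have b: "b = \<iota> - d - \<delta> * real n + w"
  proof -
    have "(\<Sum>i\<in>I. mu i) = (\<Sum>i\<in>idle S \<union> ({i. i \<in> I \<and> fst S i = 1} \<union> {i. i \<in> I \<and> 2 \<le> fst S i}). mu i)"
      by (rule sum.cong) auto
    also have "\<dots> = w + (\<iota> + (\<Sum>i | i \<in> I \<and> 2 \<le> fst S i. mu i))"
      unfolding w_def \<iota>_def idling_rate_def by (subst sum.union_disjoint, auto)+
    finally show ?thesis
      using capacity by (simp add: b_def d_def idle_arrival_rate_def arrival \<alpha>_def M_def algebra_simps)
  qed
  have w: "w \<le> mumax * M"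
  proof -
    have "w \<le> (\<Sum>i\<in>idle S. mumax)" unfolding w_def by (intro sum_mono le_mumax) auto
    then show ?thesis by (simp add: M_def idle_count_def mult.commute)
  qed
  \<comment> \<open>With few idle servers the first part carries the spare capacity. The second part
    matters only when a positive share of the servers is idle, and is paid for by
    \<open>imbalance\<close>.\<close>
  have "b = p * b + (1 - p) * b" by (simp add: algebra_simps)
  also have "p * b \<le> p * (\<iota> - d) - p * (\<delta> * real n) + p * (mumax * M)"
    using mult_left_mono[OF w p(1)] by (simp add: b algebra_simps)
  also have "p * (mumax * M) \<le> p * (\<delta> / 2 * real n)" by (rule p(4))
  also have "(1 - p) * b \<le> M / cutoff * (\<alpha> * arrival_rate P)"
  proof -
    have "0 \<le> (\<Sum>i | i \<in> I \<and> 2 \<le> fst S i. mu i)" by (intro sum_nonneg) (auto simp: service_rate_nonneg)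
    moreover have "\<alpha> * lam * (real n - M) \<le> \<alpha> * arrival_rate P"
      using \<alpha> M lam_pos unfolding arrival mult.assoc by (intro mult_left_mono) auto
    ultimately have "b \<le> \<alpha> * arrival_rate P" by (simp add: b_def)
    then have "(1 - p) * b \<le> (1 - p) * (\<alpha> * arrival_rate P)" using p by (intro mult_left_mono) auto
    also have "\<dots> \<le> M / cutoff * (\<alpha> * arrival_rate P)"
      using p \<alpha> arrival_pos by (intro mult_right_mono) auto
    finally show ?thesis .
  qed
  finally have B: "b \<le> p * (\<iota> - d) - \<delta> / 2 * real n * p + \<alpha> * arrival_rate P * M / cutoff"
    by (simp add: algebra_simps)
  have "drift (pull2_rate P) potential S = drift (pull2_rate P) excess S - drift (pull2_rate P) idle_potential S +
      real R / cutoff * drift (pull2_rate P) imbalance S"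
    unfolding drift_cmult[symmetric] drift_diff[symmetric] drift_add[symmetric] potential_def[abs_def] by simp
  also have "\<dots> \<le> b - (p * (\<iota> - d) - arrival_rate P / cutoff) +
      real R / cutoff * (- 2 * \<alpha> * arrival_rate P * M / real R + (lam + mumax) * real n)"
    using drift_excess[OF S] drift_idle_potential[OF S] drift_imbalance[OF S] R_pos cutoff_pos
    unfolding b_def \<alpha>_def M_def p_def \<iota>_def d_def
    by (intro add_mono diff_mono mult_left_mono) auto
  \<comment> \<open>The coefficient of \<open>imbalance\<close> yields its negative term twice: one
    copy absorbs the second part of \<open>b\<close>, the other survives in the conclusion.\<close>
  also have "\<dots> = b - p * (\<iota> - d) - 2 * (\<alpha> * arrival_rate P * M / cutoff) +
      (arrival_rate P + real R * (lam + mumax) * real n) / cutoff"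
    using R_pos cutoff_pos by (simp add: field_simps)
  also have "(arrival_rate P + real R * (lam + mumax) * real n) / cutoff = potential_drift_bound"
  proof -
    have "real n / cutoff = 2 * mumax / \<delta>"
      unfolding cutoff_def using \<delta>_pos mumax_pos servers_nonempty by (simp add: field_simps)
    then have "real n / cutoff * (lam + real R * (lam + mumax)) = potential_drift_bound"
      by (simp add: potential_drift_bound_def)
    then show ?thesis by (simp add: arrival algebra_simps add_divide_distrib)
  qed
  finally show ?thesis using B by (simp add: \<alpha>_def M_def p_def)
qed

text \<open>Shows that the two negative terms in the drift of \<open>potential\<close> together
  dominate a multiple of \<open>n * empty_frac\<close>.\<close>

lemma empty_frac_le:
  "empty_frac S \<le> idle_weight (card (idle S)) + empty_frac S * idle_count S / cutoff"
proof -
  define p where "p = idle_weight (card (idle S))"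
  have p: "0 \<le> p" "1 - p \<le> idle_count S / cutoff"
    using idle_weight_bounds one_minus_idle_weight_le by (auto simp: p_def idle_count_def)
  have "empty_frac S = empty_frac S * p + empty_frac S * (1 - p)" by (simp add: algebra_simps)
  also have "\<dots> \<le> 1 * p + empty_frac S * (idle_count S / cutoff)"
    using empty_frac_bounds[of S] p by (intro add_mono mult_right_mono mult_left_mono) auto
  finally show ?thesis by (simp add: p_def)
qed

section \<open>The Lyapunov function\<close>

text \<open>Large enough that both \<open>gain * \<delta> / 2\<close> and \<open>gain * lam\<close>
  are at least \<open>lam\<close>, as the two terms bounding \<open>empty_frac\<close>
  require.\<close>

definition gain :: real where
  "gain = 2 * lam / \<delta> + 1"

definition lyapunov :: "pull_state \<Rightarrow> real" where
  "lyapunov S = excess_square S + gain / (2 * real n) * (potential S)\<^sup>2"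

lemma gain_pos: "0 < gain"
  using lam_pos \<delta>_pos by (simp add: gain_def add_pos_pos)

lemma excess_nonneg: "0 \<le> excess S"
  by (simp add: excess_def sum_nonneg)

lemma lyapunov_nonneg: "0 \<le> lyapunov S"
  unfolding lyapunov_def excess_square_def using gain_pos
  by (intro add_nonneg_nonneg sum_nonneg mult_nonneg_nonneg) auto

text \<open>The bound grows with the number of servers but is uniform over states, so
  \<open>excess\<close> may replace \<open>potential\<close> as a factor at the price of a
  constant.\<close>

lemma potential_near_excess: "\<exists>K\<ge>0. \<forall>S. \<bar>potential S - excess S\<bar> \<le> K"
proof (intro exI conjI allI)
  define K where "K = real n + real R / cutoff * (real R * (real n)\<^sup>2 + (real n)\<^sup>2)"
  show "0 \<le> K" using cutoff_pos by (simp add: K_def)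
  fix S
  have m: "0 \<le> msgs S r" "msgs S r \<le> real n" for r
    by (auto simp: msgs_def intro!: card_mono)
  have "(\<Sum>r = 1..R. (msgs S r)\<^sup>2) \<le> (\<Sum>r = 1..R. (real n)\<^sup>2)"
    using m by (intro sum_mono power_mono) auto
  then have sq: "(\<Sum>r = 1..R. (msgs S r)\<^sup>2) \<le> real R * (real n)\<^sup>2" by simp
  have "(idle_count S)\<^sup>2 / real R \<le> (idle_count S)\<^sup>2 / 1"
    using routers by (intro divide_left_mono) auto
  also have "\<dots> \<le> (real n)\<^sup>2"
    using idle_count_le[of S] by (auto simp: idle_count_def intro!: power_mono)
  finally have id: "(idle_count S)\<^sup>2 / real R \<le> (real n)\<^sup>2" .
  have "\<bar>imbalance S\<bar> \<le> real R * (real n)\<^sup>2 + (real n)\<^sup>2"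
  proof -
    have "0 \<le> (\<Sum>r = 1..R. (msgs S r)\<^sup>2)" "0 \<le> (idle_count S)\<^sup>2 / real R" by (auto intro: sum_nonneg)
    moreover have "0 \<le> real R * (real n)\<^sup>2" "0 \<le> (real n)\<^sup>2" by auto
    ultimately show ?thesis using sq id unfolding imbalance_def by linarith
  qed
  then have "\<bar>real R / cutoff * imbalance S\<bar> \<le> real R / cutoff * (real R * (real n)\<^sup>2 + (real n)\<^sup>2)"
  proof -
    assume *: "\<bar>imbalance S\<bar> \<le> real R * (real n)\<^sup>2 + (real n)\<^sup>2"
    have "\<bar>real R / cutoff * imbalance S\<bar> = real R / cutoff * \<bar>imbalance S\<bar>"
      using cutoff_pos by (simp add: abs_mult)
    also have "\<dots> \<le> real R / cutoff * (real R * (real n)\<^sup>2 + (real n)\<^sup>2)"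
      using cutoff_pos by (intro mult_left_mono *) auto
    finally show ?thesis .
  qed
  then show "\<bar>potential S - excess S\<bar> \<le> K"
    using idle_potential_bounds[of S] unfolding potential_def K_def by linarith
qed

lemma excess_succ:
  assumes "0 < pull2_rate P S S'"
  shows "\<bar>excess S' - excess S\<bar> \<le> 1"
  using assms
proof (cases rule: pull2_rate_cases)
  case (arrive i)
  then show ?thesis
    using sum_fst_arrive[of i "\<lambda>q. real (q - 1)" S] by (auto simp: excess_def of_nat_diff)
next
  case (depart i r)
  then show ?thesis
    using sum_fst_depart[of i "\<lambda>q. real (q - 1)" r S] by (auto simp: excess_def of_nat_diff)
qed

text \<open>Half of the service term \<open>mumin * excess\<close> pays for the constant part of the
  drift of \<open>potential\<close>, which enters divided by n; this is what \<open>large\<close>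
  provides. The other half remains as negative drift.\<close>

lemma drift_lyapunov:
  assumes large: "gain * potential_drift_bound \<le> mumin / 2 * real n"
  shows "\<exists>D. \<forall>S\<in>pull_states P. drift (pull2_rate P) lyapunov S \<le> D - mumin / 2 * excess S"
proof -
  obtain K where K: "0 \<le> K" "\<And>S. \<bar>potential S - excess S\<bar> \<le> K"
    using potential_near_excess by blast
  \<comment> \<open>Bounds the jumps of \<open>potential\<close>: it is within \<open>K\<close> of
    \<open>excess\<close> before and after, and \<open>excess\<close> moves by at most 1.
    \<open>E\<close> below bounds the total transition rate.\<close>
  define L where "L = 2 * K + 1"
  define E where "E = real n * arrival_rate P + (\<Sum>i\<in>I. mu i)"
  define D where "D = (lam + mumax) * real n + gain / (2 * real n) * (2 * K * (E * L) + E * L\<^sup>2)"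
  have "drift (pull2_rate P) lyapunov S \<le> D - mumin / 2 * excess S" if S: "S \<in> pull_states P" for S
  proof -
    define N where "N = {S'. S' \<noteq> S \<and> 0 < pull2_rate P S S'}"
    define phi_drift where "phi_drift = drift (pull2_rate P) potential S"
    have L: "\<bar>potential S' - potential S\<bar> \<le> L" if "S' \<in> N" for S'
      using excess_succ[of S S'] K(2)[of S] K(2)[of S'] that by (auto simp: N_def L_def)
    have E: "(\<Sum>S'\<in>N. pull2_rate P S S') \<le> E" unfolding N_def E_def by (rule sum_rates_le)
    have L0: "0 \<le> L" using K by (simp add: L_def)
    have "\<bar>phi_drift\<bar> \<le> (\<Sum>S'\<in>N. \<bar>pull2_rate P S S' * (potential S' - potential S)\<bar>)"
      unfolding phi_drift_def drift_def N_def by (rule sum_abs)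
    also have "\<dots> \<le> (\<Sum>S'\<in>N. pull2_rate P S S' * L)"
    proof (rule sum_mono)
      fix S' assume "S' \<in> N"
      then show "\<bar>pull2_rate P S S' * (potential S' - potential S)\<bar> \<le> pull2_rate P S S' * L"
        using L[of S'] pull2_rate_nonneg[of S S'] by (simp add: abs_mult mult_left_mono)
    qed
    also have "\<dots> \<le> E * L"
      unfolding sum_distrib_right[symmetric] using E L0 by (intro mult_right_mono)
    finally have phi_drift: "\<bar>phi_drift\<bar> \<le> E * L" .
    have "(\<Sum>S'\<in>N. pull2_rate P S S' * (potential S' - potential S)\<^sup>2) \<le> (\<Sum>S'\<in>N. pull2_rate P S S' * L\<^sup>2)"
      using L L0 by (intro sum_mono mult_left_mono pull2_rate_nonneg) (simp add: abs_le_square_iff[symmetric])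
    also have "\<dots> \<le> E * L\<^sup>2"
      unfolding sum_distrib_right[symmetric] using E by (intro mult_right_mono) auto
    finally have sq: "(\<Sum>S'\<in>N. pull2_rate P S S' * (potential S' - potential S)\<^sup>2) \<le> E * L\<^sup>2" .
    have "potential S * phi_drift = excess S * phi_drift + (potential S - excess S) * phi_drift" by (simp add: algebra_simps)
    also have "(potential S - excess S) * phi_drift \<le> \<bar>potential S - excess S\<bar> * \<bar>phi_drift\<bar>"
      by (metis abs_ge_self abs_mult)
    also have "\<dots> \<le> K * (E * L)"
      using K phi_drift by (intro mult_mono) auto
    finally have "drift (pull2_rate P) (\<lambda>S. (potential S)\<^sup>2) S \<le>
        2 * (excess S * phi_drift) + (2 * K * (E * L) + E * L\<^sup>2)"
      unfolding drift_square using sq by (simp add: phi_drift_def N_def)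
    then have "gain / (2 * real n) * drift (pull2_rate P) (\<lambda>S. (potential S)\<^sup>2) S \<le>
        gain / (2 * real n) * (2 * (excess S * phi_drift) + (2 * K * (E * L) + E * L\<^sup>2))"
      using gain_pos by (intro mult_left_mono) auto
    then have "drift (pull2_rate P) lyapunov S \<le>
        (empty_frac S * lam - mumin) * excess S + gain / real n * (excess S * phi_drift) + D"
      using drift_excess_square[OF S]
      unfolding lyapunov_def[abs_def] drift_add drift_cmult D_def by (simp add: algebra_simps)
    also have "gain / real n * (excess S * phi_drift) \<le> excess S * (mumin / 2 - empty_frac S * lam)"
    proof -
      define x where "x = empty_frac S * idle_count S / cutoff"
      have x: "0 \<le> x" using empty_frac_bounds[of S] cutoff_pos by (simp add: x_def idle_count_def)
      have "gain / real n * phi_drift \<le> gain / real n *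
          (potential_drift_bound - \<delta> / 2 * real n * idle_weight (card (idle S)) - lam * real n * x)"
        using drift_potential[OF S] gain_pos unfolding phi_drift_def x_def arrival
        by (intro mult_left_mono) (auto simp: algebra_simps)
      also have "\<dots> = gain * potential_drift_bound / real n - gain * (\<delta> / 2) * idle_weight (card (idle S)) - gain * (lam * x)"
        using servers_nonempty by (simp add: right_diff_distrib)
      also have "\<dots> \<le> mumin / 2 - lam * idle_weight (card (idle S)) - 1 * (lam * x)"
      proof (intro diff_mono mult_right_mono)
        show "gain * potential_drift_bound / real n \<le> mumin / 2"
          using large n_pos by (simp add: pos_divide_le_eq)
        have "gain * (\<delta> / 2) = lam + \<delta> / 2" using \<delta>_pos by (simp add: gain_def field_simps)
        then show "lam \<le> gain * (\<delta> / 2)" using \<delta>_pos by simp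
        show "1 \<le> gain" using lam_pos \<delta>_pos by (simp add: gain_def)
        show "0 \<le> lam * x" using lam_pos x by simp
      qed (rule idle_weight_bounds)
      also have "\<dots> \<le> mumin / 2 - empty_frac S * lam"
      proof -
        have "lam * empty_frac S \<le> lam * (idle_weight (card (idle S)) + x)"
          unfolding x_def using empty_frac_le lam_pos by (intro mult_left_mono) auto
        then show ?thesis by (simp add: algebra_simps)
      qed
      finally have "excess S * (gain / real n * phi_drift) \<le> excess S * (mumin / 2 - empty_frac S * lam)"
        by (intro mult_left_mono excess_nonneg)
      then show ?thesis by (simp add: mult.left_commute)
    qed
    finally show ?thesis by (simp add: algebra_simps)
  qed
  then show ?thesis by blast
qed

lemma finite_excess_le: "finite {S \<in> pull_states P. excess S \<le> c}"
proof (rule finite_subset)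
  define k where "k = nat \<lceil>c\<rceil> + 1"
  let ?Q = "{Q. \<forall>i. (i \<in> I \<longrightarrow> Q i \<in> {..k}) \<and> (i \<notin> I \<longrightarrow> Q i = 0)}"
  let ?D = "{D. \<forall>i. (i \<in> I \<longrightarrow> D i \<in> {..R}) \<and> (i \<notin> I \<longrightarrow> D i = (0::nat))}"
  show "finite (?Q \<times> ?D)"
    by (rule finite_cartesian_product; rule finite_set_of_finite_funs; simp)
  show "{S \<in> pull_states P. excess S \<le> c} \<subseteq> ?Q \<times> ?D"
  proof
    fix S assume S: "S \<in> {S \<in> pull_states P. excess S \<le> c}"
    have "fst S i \<le> k" if "i \<in> I" for i
    proof -
      have "real (fst S i - 1) \<le> excess S"
        unfolding excess_def using that by (intro member_le_sum) auto
      then have "real (fst S i - 1) \<le> c" using S by simp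
      then show ?thesis unfolding k_def by linarith
    qed
    moreover have "snd S i \<le> R" if "i \<in> I" for i
      using pull_statesD(1,2)[of S i] S that by (cases "fst S i = 0") auto
    ultimately show "S \<in> ?Q \<times> ?D"
      using pull_statesD(4,5)[of S] S by (auto simp: mem_Times_iff)
  qed
qed

definition edges :: "(pull_state \<times> pull_state) set" where
  "edges = {(a, b). a \<noteq> b \<and> 0 < pull2_rate P a b}"

text \<open>A busy server receives customers only from empty routers. If no server is idle, there
  are no messages and all routers are empty.\<close>

lemma edge_arrive:
  assumes S: "S \<in> pull_states P" and i: "i \<in> open_servers S"
    and "fst S i = 0 \<or> idle S = {}"
  shows "(S, arrive i S) \<in> edges"
proof -
  have "0 < join_rate S i"
  proof (cases "fst S i = 0")
    case True
    have "{j \<in> I. snd S j = snd S i} \<noteq> {}" using i by blast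
    then have "0 < msgs S (snd S i)" by (simp add: msgs_def card_gt_0_iff)
    then have "0 < arrival_rate P / (real R * msgs S (snd S i))"
      using arrival_pos R_pos by (intro divide_pos_pos mult_pos_pos)
    moreover have "0 \<le> empty_frac S * lam"
      using lam_pos empty_frac_bounds[of S] by simp
    moreover have "join_rate S i = empty_frac S * lam + arrival_rate P / (real R * msgs S (snd S i))"
      using True i join_rate_eq[OF S, of i] by simp
    ultimately show ?thesis by linarith
  next
    case False
    then have "idle S = {}" using assms(3) by simp
    then have none: "fst S j \<noteq> 0" if "j \<in> I" for j
      using that unfolding Collect_empty_eq by (cases j) auto
    have "snd S j = 0" if "j \<in> I" for j
      using pull_statesD(2)[OF S that] none[OF that] by simp
    then have "{j \<in> I. snd S j = r} = {}" if "r \<in> {1..R}" for r using that by fastforce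
    then have "{r \<in> {1..R}. {j \<in> I. snd S j = r} = {}} = {1..R}" by blast
    then have "empty_frac S = 1" using R_pos by (simp add: empty_frac_def)
    then show ?thesis using False i join_rate_eq[OF S, of i] lam_pos by simp
  qed
  then show ?thesis
    using join_rate_le_rate[OF i] arrive_neq[of i S] by (auto simp: edges_def)
qed

lemma edge_depart:
  assumes "i \<in> busy S" "r \<in> {1..R}"
  shows "(S, depart i r S) \<in> edges"
proof -
  have "0 < mu i / real R" using mu_pos[of i] R_pos assms by simp
  then show ?thesis
    using mu_le_rate[OF assms] depart_neq[of S i r] assms by (auto simp: edges_def)
qed

text \<open>The distance to the state in which every server has exactly one customer; each unit of it
  is removed by one transition, and restored by another one.\<close>

definition dist_ones :: "pull_state \<Rightarrow> nat" where
  "dist_ones S = (\<Sum>i\<in>I. if fst S i = 0 then 1 else fst S i - 1)"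

text \<open>Filling an idle server is undone by a departure that returns its message to the same
  router. With no idle server, a service at a queue of length at least 2 creates none, so uniform
  routing can undo it.\<close>

lemma dist_ones_step:
  assumes S: "S \<in> pull_states P" and pos: "0 < dist_ones S"
  shows "\<exists>S'\<in>pull_states P. dist_ones S' < dist_ones S \<and> (S, S') \<in> edges \<and> (S', S) \<in> edges"
proof (cases "idle S = {}")
  case False
  then obtain i where i: "i \<in> idle S" by blast
  have D: "snd S i \<in> {1..R}" using pull_statesD(1)[OF S] i by blast
  have undo: "depart i (snd S i) (arrive i S) = S"
    using i by (intro prod_eqI) (auto simp: fst_arrive fst_depart snd_arrive snd_depart fun_eq_iff)
  have "dist_ones (arrive i S) < dist_ones S"
    unfolding dist_ones_def fst_arrive using i by (intro sum_strict_mono_ex1) auto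
  moreover have "(S, arrive i S) \<in> edges" using edge_arrive[OF S] idle_open[OF i] i by blast
  moreover have "(arrive i S, depart i (snd S i) (arrive i S)) \<in> edges"
    using i D by (intro edge_depart) (auto simp: fst_arrive)
  ultimately show ?thesis
    unfolding undo using arrive_in_states[OF S idle_open[OF i]]
    by (intro bexI[of _ "arrive i S"] conjI)
next
  case True
  have "\<exists>i\<in>I. 2 \<le> fst S i"
  proof (rule ccontr)
    assume no: "\<not> (\<exists>i\<in>I. 2 \<le> fst S i)"
    have "(if fst S i = 0 then 1 else fst S i - 1) = 0" if "i \<in> I" for i
    proof -
      have "fst S i \<noteq> 0" using True that unfolding Collect_empty_eq by (cases i) auto
      moreover have "\<not> 2 \<le> fst S i" using that no by blast
      ultimately show ?thesis by simp
    qed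
    then have "dist_ones S = 0" unfolding dist_ones_def by (intro sum.neutral) blast
    then show False using pos by simp
  qed
  then obtain i where i: "i \<in> I" "2 \<le> fst S i" by blast
  define S' where "S' = depart i 1 S"
  have S': "S' \<in> pull_states P"
    unfolding S'_def using S i routers by (intro depart_in_states) auto
  have "snd S i = 0" using pull_statesD(2)[OF S] i by auto
  then have undo: "arrive i S' = S"
    using i unfolding S'_def
    by (intro prod_eqI) (auto simp: fst_arrive fst_depart snd_arrive snd_depart fun_eq_iff)
  have "dist_ones S' < dist_ones S"
    unfolding dist_ones_def S'_def fst_depart using i by (intro sum_strict_mono_ex1) auto
  moreover have "(S, S') \<in> edges" unfolding S'_def using i routers by (intro edge_depart) auto
  moreover have "(S', arrive i S') \<in> edges"
  proof (intro edge_arrive S')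
    have "enat (fst S i - 1) < enat (fst S i)" using i by simp
    also have "\<dots> \<le> buffer P (fst i)" using pull_statesD(3)[OF S] i by blast
    finally show "i \<in> open_servers S'" using i by (simp add: S'_def fst_depart)
    show "fst S' i = 0 \<or> idle S' = {}" using True i by (auto simp: S'_def fst_depart)
  qed
  ultimately show ?thesis
    unfolding undo using S' by (intro bexI[of _ S'] conjI)
qed

text \<open>With no idle server there is no freedom in the message locations, so the hub is a single
  state.\<close>

lemma dist_ones_zero_unique:
  assumes "S \<in> pull_states P" "S' \<in> pull_states P" "dist_ones S = 0" "dist_ones S' = 0"
  shows "S = S'"
proof -
  have one: "fst T i = 1 \<and> snd T i = 0" if "T \<in> pull_states P" "dist_ones T = 0" "i \<in> I" for T i
  proof -
    have "(if fst T i = 0 then 1 else fst T i - 1) = 0"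
      using that(2,3) unfolding dist_ones_def by (simp only: sum_eq_0_iff finite_I)
    then have "fst T i = 1" by (auto split: if_splits)
    then show ?thesis using pull_statesD(2)[OF that(1,3)] by simp
  qed
  have "fst S i = fst S' i \<and> snd S i = snd S' i" for i
    using one[of S i] one[of S' i] pull_statesD(4,5)[of S i] pull_statesD(4,5)[of S' i] assms
    by (cases "i \<in> I") auto
  then show ?thesis by (simp add: prod_eq_iff fun_eq_iff)
qed

lemma reach_ones:
  assumes "S \<in> pull_states P"
  shows "\<exists>S1\<in>pull_states P. dist_ones S1 = 0 \<and> (S, S1) \<in> edges\<^sup>* \<and> (S1, S) \<in> edges\<^sup>*"
  using assms
proof (induction "dist_ones S" arbitrary: S rule: less_induct)
  case less
  show ?case
  proof (cases "dist_ones S = 0")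
    case True then show ?thesis using less.prems by blast
  next
    case False
    then obtain S' where S': "S' \<in> pull_states P" "dist_ones S' < dist_ones S"
        "(S, S') \<in> edges" "(S', S) \<in> edges"
      using dist_ones_step[OF less.prems] by auto
    obtain S1 where "S1 \<in> pull_states P" "dist_ones S1 = 0" "(S', S1) \<in> edges\<^sup>*" "(S1, S') \<in> edges\<^sup>*"
      using less.hyps[OF S'(2,1)] by blast
    then show ?thesis
      using S'(3,4) by (meson converse_rtrancl_into_rtrancl rtrancl.rtrancl_into_rtrancl)
  qed
qed

lemma reachable:
  assumes "S \<in> pull_states P" "S' \<in> pull_states P"
  shows "(S, S') \<in> edges\<^sup>*"
  using reach_ones[OF assms(1)] reach_ones[OF assms(2)] dist_ones_zero_unique
  by (metis rtrancl_trans)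

text \<open>Raising one queue to \<open>q\<close> strictly enlarges the set counted by the
  coordinate of level \<open>q\<close> in that pool.\<close>

lemma mean_field_neq:
  assumes "i \<in> I" and upd: "fst S' = (fst S)(i := q)" and "fst S i < q"
  shows "mean_field P S' \<noteq> mean_field P S"
proof -
  let ?A = "\<lambda>T :: pull_state. {j \<in> I. fst j = fst i \<and> q \<le> fst T j}"
  have "?A S \<subseteq> ?A S'" "i \<in> ?A S'" "i \<notin> ?A S" using assms by auto
  then have "?A S \<subset> ?A S'" by blast
  then have "card (?A S) < card (?A S')" by (intro psubset_card_mono) auto
  then have "real (card (?A S')) / real n \<noteq> real (card (?A S)) / real n"
    using servers_nonempty by simp
  moreover have "fst (mean_field P T) q (fst i) = real (card (?A T)) / real n" for T
    by (cases T) (simp add: mean_field_def)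
  ultimately show ?thesis by metis
qed

lemma mean_field_succ:
  assumes "0 < pull2_rate P S S'"
  shows "mean_field P S' \<noteq> mean_field P S"
  using assms
proof (cases rule: pull2_rate_cases)
  case (arrive i)
  then show ?thesis by (intro mean_field_neq[of i _ _ "fst S i + 1"]) (auto simp: fst_arrive)
next
  case (depart i r)
  then show ?thesis
    \<comment> \<open>A departure is read backwards, as the raising of the queue to its old
      length.\<close>
    by (intro mean_field_neq[of i _ _ "fst S i", symmetric]) (auto simp: fst_depart)
qed

lemma rate_ge_min:
  assumes "0 < pull2_rate P S S'"
  shows "min (arrival_rate P / (real R * real n)) (mumin / real R) \<le> pull2_rate P S S'"
  using assms
proof (cases rule: pull2_rate_cases)
  case (arrive i)
  have "\<exists>r\<in>{1..R}. 0 < routing_prob P S r i"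
  proof (rule ccontr)
    assume "\<not> ?thesis"
    then have "(\<Sum>r = 1..R. routing_prob P S r i) \<le> 0" by (intro sum_nonpos) (auto simp: not_less)
    then have "join_rate S i \<le> 0"
      unfolding join_rate_def using arrival_pos by (intro mult_nonneg_nonpos) auto
    then show False using arrive by simp
  qed
  then obtain r where r: "r \<in> {1..R}" "0 < routing_prob P S r i" by blast
  have "1 / real n \<le> routing_prob P S r i" using routing_prob_ge[OF r(2)] .
  also have "\<dots> \<le> (\<Sum>r = 1..R. routing_prob P S r i)"
    using r(1) by (intro member_le_sum routing_prob_nonneg) auto
  finally have "arrival_rate P / real R * (1 / real n) \<le> join_rate S i"
    unfolding join_rate_def using arrival_pos by (intro mult_left_mono) auto
  then show ?thesis using join_rate_le_rate[of i S] arrive by auto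
next
  case (depart i r)
  then have "mumin / real R \<le> mu i / real R" by (intro divide_right_mono mumin_le) auto
  then show ?thesis using mu_le_rate[of i S r] depart by auto
qed

section \<open>Ergodicity of a network of given size\<close>

lemma jump_rates_pull2:
  "jump_rates (pull2_rate P) (pull_states P)
     (min (arrival_rate P / (real R * real n)) (mumin / real R))
     (real n * arrival_rate P + (\<Sum>i\<in>I. mu i))"
proof
  show "0 < min (arrival_rate P / (real R * real n)) (mumin / real R)"
    using arrival_pos R_pos n_pos mumin_pos by simp
next
  fix S S' assume S: "S \<in> pull_states P"
  show "finite {S'. S' \<noteq> S \<and> 0 < pull2_rate P S S'}" by (rule finite_succs)
  show "0 \<le> pull2_rate P S S'" by (rule pull2_rate_nonneg)
  show "{S'. S' \<noteq> S \<and> 0 < pull2_rate P S S'} \<noteq> {}"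
  proof -
    obtain i where i: "i \<in> I" using servers_nonempty by blast
    have "\<exists>S'. (S, S') \<in> edges"
    proof (cases "fst S i = 0")
      case True
      then show ?thesis using i edge_arrive[OF S idle_open, of i] by blast
    next
      case False
      then have "(S, depart i 1 S) \<in> edges" using i routers by (intro edge_depart) auto
      then show ?thesis by blast
    qed
    then show ?thesis by (auto simp: edges_def)
  qed
  have "exit_rate (pull2_rate P) S = (\<Sum>\<^sub>\<infinity>S' | S' \<noteq> S \<and> 0 < pull2_rate P S S'. pull2_rate P S S')"
    unfolding exit_rate_def
  proof (rule infsum_cong_neutral)
    fix S' assume "S' \<in> - {S} - {S'. S' \<noteq> S \<and> 0 < pull2_rate P S S'}"
    then show "pull2_rate P S S' = 0" using pull2_rate_nonneg[of S S'] by auto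
  qed auto
  then show "exit_rate (pull2_rate P) S \<le> real n * arrival_rate P + (\<Sum>i\<in>I. mu i)"
    using sum_rates_le[of S] finite_succs[of S] by simp
  show "S' \<in> pull_states P" if "0 < pull2_rate P S S'"
    using succ_in_states[OF S that] .
  show "min (arrival_rate P / (real R * real n)) (mumin / real R) \<le> pull2_rate P S S'"
    if "0 < pull2_rate P S S'"
    using rate_ge_min[OF that] .
qed

theorem pull2_ergodic:
  assumes "gain * potential_drift_bound \<le> mumin / 2 * real n"
  shows "pull2_mean_field_ergodic P"
  unfolding pull2_mean_field_ergodic_def ergodic_image_def
proof
  show "irreducible_image (pull2_rate P) (pull_states P) (mean_field P)"
    unfolding irreducible_image_def
    using reachable[unfolded edges_def] by blast
  interpret jump_rates "pull2_rate P" "pull_states P"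
    "min (arrival_rate P / (real R * real n)) (mumin / real R)"
    "real n * arrival_rate P + (\<Sum>i\<in>I. mu i)"
    by (rule jump_rates_pull2)
  obtain D where D: "\<And>S. S \<in> pull_states P \<Longrightarrow> drift (pull2_rate P) lyapunov S \<le> D - mumin / 2 * excess S"
    using drift_lyapunov[OF assms] by blast
  show "positive_recurrent_image (pull2_rate P) (pull_states P) (mean_field P)"
  proof (rule positive_recurrent_image_Foster)
    show "(s, s') \<in> {(a, b). a \<noteq> b \<and> 0 < pull2_rate P a b}\<^sup>*"
      if "s \<in> pull_states P" "s' \<in> pull_states P" for s s'
      using reachable[OF that] by (simp add: edges_def)
    show "finite {S \<in> pull_states P. excess S \<le> 2 * (D + 1) / mumin}"
      by (rule finite_excess_le)
    show "drift (pull2_rate P) lyapunov s \<le> - 1"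
      if "s \<in> pull_states P - {S \<in> pull_states P. excess S \<le> 2 * (D + 1) / mumin}" for s
    proof -
      have "2 * (D + 1) / mumin < excess s" using that by auto
      then have "D + 1 < mumin / 2 * excess s" using mumin_pos by (simp add: field_simps)
      then show ?thesis using D[of s] that by auto
    qed
  qed (use lyapunov_nonneg mean_field_succ in auto)
qed

end

theorem theorem3:
  fixes J R :: nat
    and \<beta> \<mu> :: "nat \<Rightarrow> real"
    and B :: "nat \<Rightarrow> enat"
    and lam :: real
  assumes "1 \<le> J" and "1 \<le> R"
    and "\<And>j. j \<in> {1..J} \<Longrightarrow> 0 < \<mu> j"
    and "\<And>j. j \<in> {1..J} \<Longrightarrow> 1 \<le> B j"
    and "\<And>j. j \<in> {1..J} \<Longrightarrow> 0 < \<beta> j"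
    and "(\<Sum>j = 1..J. \<beta> j) = 1"
    and "0 < lam"
    and "lam < (\<Sum>j = 1..J. \<beta> j * \<mu> j)"
    and "\<exists>j\<in>{1..J}. B j = \<infinity>"
  shows "\<forall>\<^sub>F n in sequentially. \<forall>N :: nat \<Rightarrow> nat.
           (\<forall>j\<in>{1..J}. real (N j) = \<beta> j * real n) \<longrightarrow>
           pull2_mean_field_ergodic
             \<lparr> num_pools = J, num_routers = R, pool_size = N, buffer = B,
               service_rate = \<mu>, arrival_rate = lam * real n \<rparr>"
proof -
  define \<delta> where "\<delta> = (\<Sum>j = 1..J. \<beta> j * \<mu> j) - lam"
  define mumin mumax where "mumin = Min (\<mu> ` {1..J})" and "mumax = Max (\<mu> ` {1..J})"
  have mumin: "0 < mumin" using assms(1,3) by (simp add: mumin_def)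
  \<comment> \<open>\<open>gain * potential_drift_bound\<close> written out: the threshold for
    \<open>n\<close> must be fixed before the network, and hence the locale, is available.\<close>
  define c where "c = (2 * lam / \<delta> + 1) * (2 * mumax / \<delta> * (lam + real R * (lam + mumax)))"
  have "\<forall>\<^sub>F n :: nat in sequentially. 2 * c / mumin \<le> real n"
    using filterlim_real_sequentially by (simp add: filterlim_at_top)
  then show ?thesis
    using eventually_gt_at_top[of 0]
  proof eventually_elim
    case (elim m)
    show ?case
    proof (intro allI impI)
      fix N :: "nat \<Rightarrow> nat" assume N: "\<forall>j\<in>{1..J}. real (N j) = \<beta> j * real m"
      define P where "P = \<lparr> num_pools = J, num_routers = R, pool_size = N, buffer = B,
               service_rate = \<mu>, arrival_rate = lam * real m \<rparr>"
      \<comment> \<open>With \<open>g = 1\<close> it identifies the scaling parameter with the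
        number of servers; with \<mu> it gives the total capacity.\<close>
      have sum_servers: "(\<Sum>i\<in>servers P. g (fst i)) = (\<Sum>j = 1..J. \<beta> j * g j) * real m" for g :: "nat \<Rightarrow> real"
      proof -
        have "(\<Sum>i\<in>servers P. g (fst i)) = (\<Sum>(j, k)\<in>(SIGMA j : {1..J}. {1..N j}). g j)"
          by (simp add: servers_def P_def case_prod_unfold)
        also have "\<dots> = (\<Sum>j = 1..J. \<Sum>k = 1..N j. g j)"
          by (rule sum.Sigma[symmetric]) auto
        also have "\<dots> = (\<Sum>j = 1..J. \<beta> j * g j * real m)"
          using N by (intro sum.cong refl) simp
        finally show ?thesis by (simp add: sum_distrib_right)
      qed
      have card: "real (card (servers P)) = real m"
        using sum_servers[of "\<lambda>_. 1"] assms(6) by simp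
      have pool: "fst i \<in> {1..J}" if "i \<in> servers P" for i
        using that by (auto simp: servers_def P_def)
      interpret pull_network P mumin mumax lam \<delta>
      proof
        show "1 \<le> num_routers P" using assms(2) by (simp add: P_def)
        show "1 \<le> buffer P (fst i)" if "i \<in> servers P" for i
          using assms(4) pool[OF that] by (simp add: P_def)
        show "servers P \<noteq> {}" using card elim(2) by force
        show "mumin \<le> service_rate P (fst i)" "service_rate P (fst i) \<le> mumax"
          if "i \<in> servers P" for i
          using pool[OF that] by (auto simp: P_def mumin_def mumax_def)
        show "arrival_rate P = lam * real (card (servers P))" using card by (simp add: P_def)
        show "(\<Sum>i\<in>servers P. service_rate P (fst i)) = (lam + \<delta>) * real (card (servers P))"
          using sum_servers[of \<mu>] card by (simp add: P_def \<delta>_def)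
      qed (use mumin assms(7,8) in \<open>auto simp: \<delta>_def\<close>)
      have "num_routers P = R" by (simp add: P_def)
      then have "c = gain * potential_drift_bound"
        by (simp add: c_def gain_def potential_drift_bound_def)
      then have "gain * potential_drift_bound \<le> mumin / 2 * real (card (servers P))"
        using elim(1) mumin card by (simp add: field_simps)
      then show "pull2_mean_field_ergodic \<lparr> num_pools = J, num_routers = R, pool_size = N, buffer = B,
               service_rate = \<mu>, arrival_rate = lam * real m \<rparr>"
        using pull2_ergodic unfolding P_def by blast
    qed
  qed
qed

end
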